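(* Let $G$ be a group generated as a monoid by a subset $A\subseteq G$ closed under $G$-conjugation, let $c\in G$ with $A_c$ finite, and let $n=\ell_A(c)\ge 3$. Assume there exists $a\in A_c$ such that, apart possibly from $a^2$, there is exactly one element of $\mathcal{P}_c$ covering $a$. Then the following holds: if $\mathcal{P}_c$ is totally chain-connected and $\prec$ is a $c$-compatible order of $A_c$, then for every $g\in\mathcal{P}_c$ the reduced cycle graph $\Gamma_{\prec_g}(\mathcal{P}_g)$ induces a linear order, where $\prec_g$ denotes the restriction of $\prec$ to $A_g$.
   Context: For $x\in G$, $\ell_A(x)$ is the least $k\ge 0$ such that $x$ is a product of $k$ elements of $A$; a reduced $A$-factorization is such a product with $k=\ell_A(x)$, written as a tuple. $x\le_A y$ iff $\ell_A(x)+\ell_A(x^{-1}y)=\ell_A(y)$; $\mathcal{P}_g=[e,g]_A$ ordered by $\le_A$, $A_g=\{b\in A: b\le_A g\}$, $R_g=\{h: h\le_A g,\ \ell_A(h)=2\}$. The chain graph of a bounded graded poset has maximal chains as vertices, adjacent when they differ in exactly one element; the poset is chain-connected if this graph is connected and totally chain-connected if every interval is chain-connected. A linear order $\prec$ on $A_c$ is $c$-compatible if every $h\in R_c$ has exactly one reduced $A$-factorization $(x,y)$ with $x\preceq y$. The cycle graph $\Gamma(\mathcal{P}_g)$ has vertex set $A_g$ and a directed edge $x\to y$ (possibly a loop) labeled $xy$ whenever $xy\in R_g$. For a linear order $\prec'$ of $A_g$, the reduced cycle graph $\Gamma_{\prec'}(\mathcal{P}_g)$ is obtained by removing the edges $x\to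 y$ with $x\preceq' y$. A directed graph induces a linear order if the relation "$u=v$ or there is a directed path from $u$ to $v$" is a total order on its vertices.
   Formalization: The formal theorem additionally assumes that the identity e is not in A; if e is in A, it is an isolated vertex of the reduced cycle graph of P_c, which has other vertices, so the claim as written always fails. *)

theory Defs
  imports "HOL-Algebra.Group" "Graph_Theory.Graph_Theory"
begin

section \<open>Chain-connected posets\<close>

text \<open>A poset is given by a carrier set \<open>P\<close> and a (reflexive) relation \<open>leq\<close>, which is
  only ever evaluated on \<open>P\<close>.\<close>

definition poset_interval :: "'p set \<Rightarrow> ('p \<Rightarrow> 'p \<Rightarrow> bool) \<Rightarrow> 'p \<Rightarrow> 'p \<Rightarrow> 'p set" where
  "poset_interval P leq x y = {z \<in> P. leq x z \<and> leq z y}"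

definition poset_covers :: "'p set \<Rightarrow> ('p \<Rightarrow> 'p \<Rightarrow> bool) \<Rightarrow> 'p \<Rightarrow> 'p \<Rightarrow> bool" where
  "poset_covers P leq x y \<longleftrightarrow>
     x \<in> P \<and> y \<in> P \<and> leq x y \<and> x \<noteq> y \<and>
     \<not> (\<exists>z\<in>P. z \<noteq> x \<and> z \<noteq> y \<and> leq x z \<and> leq z y)"

text \<open>The chain graph is undirected, so it is encoded as a symmetric digraph. Two chains differ
  in exactly one element if each has exactly one element that the other one lacks.\<close>

definition chain_graph :: "'p set \<Rightarrow> ('p \<Rightarrow> 'p \<Rightarrow> bool) \<Rightarrow> 'p set pair_pre_digraph" where
  "chain_graph P leq =
     \<lparr> pverts = {C. pred_on.maxchain P leq C},
       parcs = {(C, D). pred_on.maxchain P leq C \<and> pred_on.maxchain P leq D \<and>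
                        card (C - D) = 1 \<and> card (D - C) = 1} \<rparr>"

definition chain_connected :: "'p set \<Rightarrow> ('p \<Rightarrow> 'p \<Rightarrow> bool) \<Rightarrow> bool" where
  "chain_connected P leq \<longleftrightarrow> connected (with_proj (chain_graph P leq))"

definition totally_chain_connected :: "'p set \<Rightarrow> ('p \<Rightarrow> 'p \<Rightarrow> bool) \<Rightarrow> bool" where
  "totally_chain_connected P leq \<longleftrightarrow>
     (\<forall>x\<in>P. \<forall>y\<in>P. leq x y \<longrightarrow> chain_connected (poset_interval P leq x y) leq)"


section \<open>Factorization posets\<close>

definition word_prod :: "('a, 'b) monoid_scheme \<Rightarrow> 'a list \<Rightarrow> 'a" where
  "word_prod G xs = foldr (\<otimes>\<^bsub>G\<^esub>) xs \<one>\<^bsub>G\<^esub>"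

definition generates_as_monoid :: "('a, 'b) monoid_scheme \<Rightarrow> 'a set \<Rightarrow> bool" where
  "generates_as_monoid G A \<longleftrightarrow>
     A \<subseteq> carrier G \<and> (\<forall>x\<in>carrier G. \<exists>xs. set xs \<subseteq> A \<and> word_prod G xs = x)"

definition conjugation_closed :: "('a, 'b) monoid_scheme \<Rightarrow> 'a set \<Rightarrow> bool" where
  "conjugation_closed G A \<longleftrightarrow>
     (\<forall>g\<in>carrier G. \<forall>a\<in>A. inv\<^bsub>G\<^esub> g \<otimes>\<^bsub>G\<^esub> a \<otimes>\<^bsub>G\<^esub> g \<in> A)"

definition word_length :: "('a, 'b) monoid_scheme \<Rightarrow> 'a set \<Rightarrow> 'a \<Rightarrow> nat" where
  "word_length G A x = (LEAST k. \<exists>xs. set xs \<subseteq> A \<and> length xs = k \<and> word_prod G xs = x)"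

definition reduced_factorizations :: "('a, 'b) monoid_scheme \<Rightarrow> 'a set \<Rightarrow> 'a \<Rightarrow> 'a list set" where
  "reduced_factorizations G A x =
     {xs. set xs \<subseteq> A \<and> length xs = word_length G A x \<and> word_prod G xs = x}"

definition prefix_le :: "('a, 'b) monoid_scheme \<Rightarrow> 'a set \<Rightarrow> 'a \<Rightarrow> 'a \<Rightarrow> bool" where
  "prefix_le G A x y \<longleftrightarrow>
     word_length G A x + word_length G A (inv\<^bsub>G\<^esub> x \<otimes>\<^bsub>G\<^esub> y) = word_length G A y"

definition fact_poset :: "('a, 'b) monoid_scheme \<Rightarrow> 'a set \<Rightarrow> 'a \<Rightarrow> 'a set" where
  "fact_poset G A g = poset_interval (carrier G) (prefix_le G A) \<one>\<^bsub>G\<^esub> g"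

text \<open>If \<open>\<one>\<close> is not in \<open>A\<close>, these are the atoms of \<open>fact_poset G A g\<close>. An identity element
  in \<open>A\<close> would have length \<open>0\<close> and be an isolated vertex of every cycle graph below.\<close>

definition gens_below :: "('a, 'b) monoid_scheme \<Rightarrow> 'a set \<Rightarrow> 'a \<Rightarrow> 'a set" where
  "gens_below G A g = {b \<in> A. prefix_le G A b g}"

definition rank_two_below :: "('a, 'b) monoid_scheme \<Rightarrow> 'a set \<Rightarrow> 'a \<Rightarrow> 'a set" where
  "rank_two_below G A g = {h \<in> carrier G. prefix_le G A h g \<and> word_length G A h = 2}"


section \<open>Compatible orders and cycle graphs\<close>

text \<open>Linear orders are reflexive relations: \<open>(x, y) \<in> r\<close> encodes \<open>x \<preceq> y\<close>.\<close>

definition compatible_order :: "('a, 'b) monoid_scheme \<Rightarrow> 'a set \<Rightarrow> 'a \<Rightarrow> 'a rel \<Rightarrow> bool" where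
  "compatible_order G A c r \<longleftrightarrow>
     linear_order_on (gens_below G A c) r \<and>
     (\<forall>h\<in>rank_two_below G A c.
        \<exists>!p. [fst p, snd p] \<in> reduced_factorizations G A h \<and> p \<in> r)"

text \<open>The arc \<open>(x, h, y)\<close> is the edge from \<open>x\<close> to \<open>y\<close> with label \<open>h\<close>.\<close>

definition cycle_graph ::
    "('a, 'b) monoid_scheme \<Rightarrow> 'a set \<Rightarrow> 'a \<Rightarrow> ('a, 'a \<times> 'a \<times> 'a) pre_digraph" where
  "cycle_graph G A g =
     \<lparr> verts = gens_below G A g,
       arcs = {(x, h, y). x \<in> gens_below G A g \<and> y \<in> gens_below G A g \<and>
                          h = x \<otimes>\<^bsub>G\<^esub> y \<and> h \<in> rank_two_below G A g},
       tail = (\<lambda>(x, h, y). x),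
       head = (\<lambda>(x, h, y). y) \<rparr>"

definition reduced_cycle_graph ::
    "('a, 'b) monoid_scheme \<Rightarrow> 'a set \<Rightarrow> 'a \<Rightarrow> 'a rel \<Rightarrow> ('a, 'a \<times> 'a \<times> 'a) pre_digraph" where
  "reduced_cycle_graph G A g r =
     (cycle_graph G A g)
       \<lparr> arcs := {e \<in> arcs (cycle_graph G A g). arc_to_ends (cycle_graph G A g) e \<notin> r} \<rparr>"

definition induces_linear_order :: "('v, 'e) pre_digraph \<Rightarrow> bool" where
  "induces_linear_order D \<longleftrightarrow> linear_order_on (verts D) {(u, v). u \<rightarrow>\<^sup>*\<^bsub>D\<^esub> v}"

end

theory Submission
  imports Defs
begin

text \<open>Let \<open>d = a\<inverse>c\<close>. The covers of \<open>a\<close> are the products \<open>au\<close> with \<open>u\<close> a generator below \<open>d\<close>, so the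
  generators below \<open>d\<close> are \<open>b\<close> and possibly \<open>a\<close>. A compatible order forces the factorizations of every
  rank two element to form one cycle, along which the generators descend exactly once around. Hence only
  the cyclic order of the generators matters, and reachability in the reduced cycle graph of \<open>g\<close> is
  total once any two generators below \<open>g\<close> that are adjacent in the order have a common upper cover.

  If \<open>a\<close> and \<open>b\<close> commute, then they are the only generators below \<open>c\<close>. Otherwise \<open>c = ab\<^sup>m\<close> with
  \<open>m \<ge> 2\<close>, and the cycle of \<open>ab\<close> has length three: with four or more generators on it, conjugation by
  \<open>ab\<^sup>2\<close> would map an arc of the cyclic order strictly into itself. So \<open>a\<close> and \<open>b\<close> satisfy the braid
  relation. In the same way, \<open>m \<ge> 4\<close> is impossible since \<open>ab\<^sup>4\<close> commutes with a generator. For \<open>m = 2\<close> and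
  \<open>m = 3\<close> there are four and six generators below \<open>c\<close>, found by closing up under the cycles.\<close>

section \<open>Length function\<close>

text \<open>With \<open>\<one>\<close> excluded from \<open>A\<close>, the generators are precisely
  the elements of length one (\<open>len_gen\<close>, \<open>len_eq_1\<close>).\<close>

locale generated_group = group G for G (structure) +
  fixes A :: "'a set"
  assumes generates: "generates_as_monoid G A"
    and conj_closed: "conjugation_closed G A"
    and one_notin: "\<one> \<notin> A"
begin

abbreviation len :: "'a \<Rightarrow> nat" where "len \<equiv> word_length G A"
abbreviation le :: "'a \<Rightarrow> 'a \<Rightarrow> bool" (infix \<open>\<preceq>\<close> 50) where "x \<preceq> y \<equiv> prefix_le G A x y"
abbreviation B :: "'a \<Rightarrow> 'a set" where "B \<equiv> gens_below G A"
abbreviation R :: "'a \<Rightarrow> 'a set" where "R \<equiv> rank_two_below G A"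

lemma gens_closed: "A \<subseteq> carrier G"
  using generates by (simp add: generates_as_monoid_def)

lemma gen_closed [simp, intro]: "a \<in> A \<Longrightarrow> a \<in> carrier G"
  using gens_closed by blast

lemma word_prod_Nil [simp]: "word_prod G [] = \<one>"
  by (simp add: word_prod_def)

lemma word_prod_Cons [simp]: "word_prod G (x # xs) = x \<otimes> word_prod G xs"
  by (simp add: word_prod_def)

lemma word_prod_closed [simp]: "set xs \<subseteq> A \<Longrightarrow> word_prod G xs \<in> carrier G"
  by (induction xs) auto

lemma word_prod_append [simp]:
  "set xs \<subseteq> A \<Longrightarrow> set ys \<subseteq> A \<Longrightarrow> word_prod G (xs @ ys) = word_prod G xs \<otimes> word_prod G ys"
  by (induction xs) (auto simp: m_assoc)

lemma reduced_word:
  assumes "x \<in> carrier G"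
  obtains xs where "set xs \<subseteq> A" "length xs = len x" "word_prod G xs = x"
proof -
  obtain xs where "set xs \<subseteq> A" "word_prod G xs = x"
    using generates assms by (auto simp: generates_as_monoid_def)
  then have "\<exists>k xs. set xs \<subseteq> A \<and> length xs = k \<and> word_prod G xs = x" by blast
  from LeastI_ex[OF this] show ?thesis
    using that unfolding word_length_def by blast
qed

lemma len_word_prod_le: "set xs \<subseteq> A \<Longrightarrow> len (word_prod G xs) \<le> length xs"
  unfolding word_length_def by (rule Least_le) blast

lemma len_one [simp]: "len \<one> = 0"
  using len_word_prod_le[of "[]"] by simp

lemma len_eq_0: "x \<in> carrier G \<Longrightarrow> len x = 0 \<longleftrightarrow> x = \<one>"
  by (metis len_one length_0_conv reduced_word word_prod_Nil)

lemma len_mult_le: "x \<in> carrier G \<Longrightarrow> y \<in> carrier G \<Longrightarrow> len (x \<otimes> y) \<le> len x + len y"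
proof -
  assume xy: "x \<in> carrier G" "y \<in> carrier G"
  obtain xs where xs: "set xs \<subseteq> A" "length xs = len x" "word_prod G xs = x"
    using reduced_word xy by blast
  obtain ys where ys: "set ys \<subseteq> A" "length ys = len y" "word_prod G ys = y"
    using reduced_word xy by blast
  show ?thesis using len_word_prod_le[of "xs @ ys"] xs ys by simp
qed

lemma len_gen [simp]: "a \<in> A \<Longrightarrow> len a = 1"
proof -
  assume a: "a \<in> A"
  then have "len a \<le> 1" using len_word_prod_le[of "[a]"] by simp
  moreover have "len a \<noteq> 0" using a one_notin len_eq_0 by auto
  ultimately show ?thesis by linarith
qed

lemma len_eq_1: "x \<in> carrier G \<Longrightarrow> len x = 1 \<Longrightarrow> x \<in> A"
proof -
  assume x: "x \<in> carrier G" "len x = 1"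
  obtain xs where xs: "set xs \<subseteq> A" "length xs = len x" "word_prod G xs = x"
    using reduced_word x by blast
  then show ?thesis using x by (cases xs) auto
qed

lemma first_letter:
  assumes "x \<in> carrier G" "0 < len x"
  obtains a y where "a \<in> A" "y \<in> carrier G" "x = a \<otimes> y" "len x = Suc (len y)"
proof -
  obtain xs where xs: "set xs \<subseteq> A" "length xs = len x" "word_prod G xs = x"
    using reduced_word assms by blast
  then obtain a ys where ys: "xs = a # ys" using assms by (cases xs) auto
  have "len (word_prod G ys) \<le> length ys" using len_word_prod_le ys xs by simp
  moreover have "len x \<le> Suc (len (word_prod G ys))"
    using len_mult_le[of a "word_prod G ys"] xs ys by auto
  ultimately have "len x = Suc (len (word_prod G ys))" using xs ys by simp
  then show ?thesis using that[of a "word_prod G ys"] xs ys by auto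
qed

lemma inv_mult_cancel [simp]:
  "x \<in> carrier G \<Longrightarrow> y \<in> carrier G \<Longrightarrow> inv x \<otimes> (x \<otimes> y) = y"
  "x \<in> carrier G \<Longrightarrow> y \<in> carrier G \<Longrightarrow> x \<otimes> (inv x \<otimes> y) = y"
  by (simp_all flip: m_assoc)

lemma conj_gen: "g \<in> carrier G \<Longrightarrow> a \<in> A \<Longrightarrow> inv g \<otimes> a \<otimes> g \<in> A"
  using conj_closed by (simp add: conjugation_closed_def)

lemma conj_gen': "g \<in> carrier G \<Longrightarrow> a \<in> A \<Longrightarrow> g \<otimes> a \<otimes> inv g \<in> A"
  using conj_gen[of "inv g" a] by simp

lemma conj_mult:
  "g \<in> carrier G \<Longrightarrow> x \<in> carrier G \<Longrightarrow> y \<in> carrier G \<Longrightarrow>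
    inv g \<otimes> (x \<otimes> y) \<otimes> g = (inv g \<otimes> x \<otimes> g) \<otimes> (inv g \<otimes> y \<otimes> g)"
  by (simp add: m_assoc)

text \<open>Conjugating a reduced word letter by letter gives a word in \<open>A\<close> with
  equally many letters. Conjugating back then yields equality in \<open>len_conj\<close>.\<close>

lemma len_conj_le:
  assumes "g \<in> carrier G" "x \<in> carrier G"
  shows "len (inv g \<otimes> x \<otimes> g) \<le> len x"
proof -
  have "set xs \<subseteq> A \<Longrightarrow> inv g \<otimes> word_prod G xs \<otimes> g = word_prod G (map (\<lambda>a. inv g \<otimes> a \<otimes> g) xs)" for xs
    by (induction xs) (use assms in \<open>auto simp: conj_mult\<close>)
  moreover obtain xs where xs: "set xs \<subseteq> A" "length xs = len x" "word_prod G xs = x"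
    using reduced_word assms by blast
  ultimately show ?thesis
    using len_word_prod_le[of "map (\<lambda>a. inv g \<otimes> a \<otimes> g) xs"] conj_gen[OF assms(1)] by force
qed

lemma conj_conj_inv:
  "g \<in> carrier G \<Longrightarrow> x \<in> carrier G \<Longrightarrow> g \<otimes> (inv g \<otimes> x \<otimes> g) \<otimes> inv g = x"
  by (simp add: m_assoc)

lemma len_conj [simp]:
  assumes "g \<in> carrier G" "x \<in> carrier G"
  shows "len (inv g \<otimes> x \<otimes> g) = len x"
  using len_conj_le[of g x] len_conj_le[of "inv g" "inv g \<otimes> x \<otimes> g"] assms
  by (simp add: conj_conj_inv)


subsection \<open>The prefix order\<close>

lemma le_mult_iff:
  "x \<in> carrier G \<Longrightarrow> y \<in> carrier G \<Longrightarrow> x \<preceq> x \<otimes> y \<longleftrightarrow> len (x \<otimes> y) = len x + len y"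
  by (auto simp: prefix_le_def)

lemma le_refl [simp]: "x \<in> carrier G \<Longrightarrow> x \<preceq> x"
  by (simp add: prefix_le_def)

lemma one_le [simp]: "x \<in> carrier G \<Longrightarrow> \<one> \<preceq> x"
  by (simp add: prefix_le_def)

lemma leE:
  assumes "x \<preceq> z" "x \<in> carrier G" "z \<in> carrier G"
  obtains y where "y \<in> carrier G" "z = x \<otimes> y" "len z = len x + len y" "y = inv x \<otimes> z"
proof (rule that)
  show "inv x \<otimes> z \<in> carrier G" "z = x \<otimes> (inv x \<otimes> z)" using assms by simp_all
  show "len z = len x + len (inv x \<otimes> z)" using assms(1) unfolding prefix_le_def by linarith
qed (rule refl)

lemma le_len: "x \<preceq> z \<Longrightarrow> len x \<le> len z"
  by (auto simp: prefix_le_def)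

lemma le_len_eq: "x \<preceq> y \<Longrightarrow> x \<in> carrier G \<Longrightarrow> y \<in> carrier G \<Longrightarrow> len x = len y \<Longrightarrow> x = y"
  by (metis add_cancel_right_right leE len_eq_0 r_one)

text \<open>Subadditivity bounds the total through either grouping of the factors, so additivity
  over all three leaves no slack in any partial product.\<close>

lemma le_mult3:
  assumes "x \<in> carrier G" "y \<in> carrier G" "z \<in> carrier G"
    and "len (x \<otimes> (y \<otimes> z)) = len x + len y + len z"
  shows "len (x \<otimes> y) = len x + len y" "len (y \<otimes> z) = len y + len z" "x \<preceq> x \<otimes> (y \<otimes> z)"
    "x \<otimes> y \<preceq> x \<otimes> (y \<otimes> z)" "x \<preceq> x \<otimes> y" "y \<preceq> y \<otimes> z"
proof -
  have 1: "len (x \<otimes> y) \<le> len x + len y" "len (y \<otimes> z) \<le> len y + len z" 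
      "len (x \<otimes> (y \<otimes> z)) \<le> len x + len (y \<otimes> z)"
    using len_mult_le[of x y] len_mult_le[of y z] len_mult_le[of x "y \<otimes> z"] assms by simp_all
  have 2: "len (x \<otimes> (y \<otimes> z)) \<le> len (x \<otimes> y) + len z"
    using len_mult_le[of "x \<otimes> y" z] assms by (auto simp: m_assoc)
  show 3: "len (x \<otimes> y) = len x + len y" "len (y \<otimes> z) = len y + len z"
    using 1 2 assms(4) by linarith+
  show "x \<preceq> x \<otimes> (y \<otimes> z)" "x \<preceq> x \<otimes> y" "y \<preceq> y \<otimes> z"
    using 3 assms by (auto simp: le_mult_iff)
  show "x \<otimes> y \<preceq> x \<otimes> (y \<otimes> z)"
    using le_mult_iff[of "x \<otimes> y" z] 3 assms by (auto simp: m_assoc)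
qed

lemma le_trans:
  assumes "x \<preceq> y" "y \<preceq> z" "x \<in> carrier G" "y \<in> carrier G" "z \<in> carrier G"
  shows "x \<preceq> z"
proof -
  obtain u where u: "u \<in> carrier G" "y = x \<otimes> u" "len y = len x + len u" using leE assms by metis
  obtain v where v: "v \<in> carrier G" "z = y \<otimes> v" "len z = len y + len v" using leE assms by metis
  show ?thesis using le_mult3(3)[of x u v] u v assms by (simp add: m_assoc)
qed

text \<open>Rewriting \<open>x \<otimes> y\<close> as
  \<open>y \<otimes> (inv y \<otimes> x \<otimes> y)\<close> turns the suffix into a prefix, and
  conjugation preserves length.\<close>

lemma suffix_le:
  assumes "x \<in> carrier G" "y \<in> carrier G" "len (x \<otimes> y) = len x + len y"
  shows "y \<preceq> x \<otimes> y"
proof -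
  have "x \<otimes> y = y \<otimes> (inv y \<otimes> x \<otimes> y)" using assms by (simp add: m_assoc)
  then show ?thesis
    using assms le_mult_iff[of y "inv y \<otimes> x \<otimes> y"] by simp
qed

lemma suffix_le': "x \<preceq> z \<Longrightarrow> x \<in> carrier G \<Longrightarrow> z \<in> carrier G \<Longrightarrow> inv x \<otimes> z \<preceq> z"
  by (metis leE suffix_le)

lemma conj_le:
  assumes "x \<preceq> z" "x \<in> carrier G" "z \<in> carrier G" "g \<in> carrier G"
  shows "inv g \<otimes> x \<otimes> g \<preceq> inv g \<otimes> z \<otimes> g"
proof -
  obtain y where y: "y \<in> carrier G" "z = x \<otimes> y" "len z = len x + len y" using leE assms by metis
  have e: "inv g \<otimes> z \<otimes> g = (inv g \<otimes> x \<otimes> g) \<otimes> (inv g \<otimes> y \<otimes> g)"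
    using y assms conj_mult by simp
  have "len (inv g \<otimes> z \<otimes> g) = len (inv g \<otimes> x \<otimes> g) + len (inv g \<otimes> y \<otimes> g)"
    unfolding len_conj[OF assms(4,3)] len_conj[OF assms(4,2)] len_conj[OF assms(4) y(1)] by (rule y(3))
  then show ?thesis unfolding e using le_mult_iff[of "inv g \<otimes> x \<otimes> g" "inv g \<otimes> y \<otimes> g"] y assms by blast
qed

lemma conj_self_le:
  assumes "x \<preceq> g" "x \<in> carrier G" "g \<in> carrier G"
  shows "inv g \<otimes> x \<otimes> g \<preceq> g"
  using conj_le[OF assms assms(3)] assms by (simp add: m_assoc)


subsection \<open>Generators below an element\<close>

lemma B_iff: "t \<in> B g \<longleftrightarrow> t \<in> A \<and> t \<preceq> g"
  by (simp add: gens_below_def)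

lemma R_iff: "k \<in> R g \<longleftrightarrow> k \<in> carrier G \<and> k \<preceq> g \<and> len k = 2"
  by (simp add: rank_two_below_def)

lemma B_mono: "g \<preceq> g' \<Longrightarrow> g \<in> carrier G \<Longrightarrow> g' \<in> carrier G \<Longrightarrow> B g \<subseteq> B g'"
  using le_trans by (fastforce simp: B_iff)

lemma R_mono: "g \<preceq> g' \<Longrightarrow> g \<in> carrier G \<Longrightarrow> g' \<in> carrier G \<Longrightarrow> R g \<subseteq> R g'"
  using le_trans by (fastforce simp: R_iff)

lemma B_gen: "a \<in> A \<Longrightarrow> B a = {a}"
  by (auto simp: B_iff) (metis gen_closed le_len_eq len_gen)

lemma B_nonempty: "g \<in> carrier G \<Longrightarrow> g \<noteq> \<one> \<Longrightarrow> B g \<noteq> {}"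
proof -
  assume g: "g \<in> carrier G" "g \<noteq> \<one>"
  then obtain a y where "a \<in> A" "y \<in> carrier G" "g = a \<otimes> y" "len g = Suc (len y)"
    using first_letter[of g] len_eq_0[of g] by auto
  then show ?thesis using le_mult_iff[of a y] by (auto simp: B_iff)
qed

lemma B_rank2:
  assumes "k \<in> carrier G" "len k = 2"
  shows "t \<in> B k \<longleftrightarrow> t \<in> A \<and> inv t \<otimes> k \<in> A"
proof -
  have "t \<preceq> k \<longleftrightarrow> len (inv t \<otimes> k) = 1" if "t \<in> A"
    using that assms unfolding prefix_le_def by auto
  moreover have "len (inv t \<otimes> k) = 1 \<longleftrightarrow> inv t \<otimes> k \<in> A" if "t \<in> A"
    using that assms len_eq_1[of "inv t \<otimes> k"] by auto
  ultimately show ?thesis by (auto simp: B_iff)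
qed

lemma B_rank2_mult:
  assumes "k \<in> carrier G" "len k = 2" "s \<in> A" "t \<in> A" "s \<otimes> t = k"
  shows "s \<in> B k" "t \<in> B k" "inv s \<otimes> k = t"
proof -
  show 1: "inv s \<otimes> k = t" using assms by auto
  show "s \<in> B k" using assms 1 by (auto simp: B_rank2)
  have "inv t \<otimes> k = inv t \<otimes> s \<otimes> t" using assms by (auto simp: m_assoc)
  then show "t \<in> B k" using assms conj_gen[of t s] by (auto simp: B_rank2)
qed

text \<open>The map sending \<open>t\<close> to \<open>inv t \<otimes> k\<close> follows the edges
  labeled \<open>k\<close> of the cycle graph. Together with \<open>prev_B\<close> and
  \<open>next_inj\<close> it is a permutation of \<open>B k\<close>, whose orbits are the cycles of
  \<open>k\<close>.\<close>

lemma next_B: "k \<in> carrier G \<Longrightarrow> len k = 2 \<Longrightarrow> t \<in> B k \<Longrightarrow> inv t \<otimes> k \<in> B k"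
  using B_rank2_mult(2)[of k t "inv t \<otimes> k"] B_rank2[of k t] by auto

lemma prev_B:
  assumes "k \<in> carrier G" "len k = 2" "t \<in> B k"
  obtains s where "s \<in> B k" "inv s \<otimes> k = t"
proof -
  have t: "t \<in> A" "inv t \<otimes> k \<in> A" using assms by (auto simp: B_rank2)
  define s where "s = t \<otimes> (inv t \<otimes> k) \<otimes> inv t"
  have "s \<in> A" unfolding s_def using t conj_gen' by blast
  moreover have "s \<otimes> t = k" unfolding s_def using t assms by (simp add: m_assoc)
  ultimately show ?thesis using that B_rank2_mult[of k s t] assms t by blast
qed

lemma next_inj:
  assumes "k \<in> carrier G" "s \<in> carrier G" "t \<in> carrier G" "inv s \<otimes> k = inv t \<otimes> k"
  shows "s = t"
  using assms by (metis inv_closed inv_inj inj_onD right_cancel)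

lemma pair_in_R:
  assumes "t \<in> B g" "u \<in> B (inv t \<otimes> g)" "g \<in> carrier G"
  shows "t \<otimes> u \<in> R g"
proof -
  have t: "t \<in> A" "u \<in> A" using assms by (auto simp: B_iff)
  then have tc: "t \<in> carrier G" "u \<in> carrier G" by auto
  have le: "t \<preceq> g" "u \<preceq> inv t \<otimes> g" using assms by (auto simp: B_iff)
  obtain y where y: "y \<in> carrier G" "g = t \<otimes> y" "len g = len t + len y" "y = inv t \<otimes> g"
    using leE[OF le(1) tc(1) assms(3)] by blast
  have "u \<preceq> y" using le(2) y(4) by simp
  then obtain z where z: "z \<in> carrier G" "y = u \<otimes> z" "len y = len u + len z"
    using leE[OF _ tc(2) y(1)] by blast
  have e: "g = t \<otimes> (u \<otimes> z)" and l: "len (t \<otimes> (u \<otimes> z)) = len t + len u + len z"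
    using y(2,3) z(2,3) by auto
  show ?thesis
    unfolding R_iff e using le_mult3(1,4)[OF tc z(1) l] tc len_gen[OF t(1)] len_gen[OF t(2)] by simp
qed


section \<open>Connectivity of the generators\<close>

lemma fact_poset_iff: "z \<in> fact_poset G A g \<longleftrightarrow> z \<in> carrier G \<and> z \<preceq> g"
  by (auto simp: fact_poset_def poset_interval_def)

lemma fact_poset_interval:
  assumes "g \<in> carrier G" "g \<preceq> c" "c \<in> carrier G"
  shows "poset_interval (fact_poset G A c) (prefix_le G A) \<one> g = fact_poset G A g"
  using assms le_trans[of _ g c] by (auto simp: fact_poset_iff poset_interval_def)

lemma comparable_le:
  assumes "x \<preceq> y \<or> y \<preceq> x \<or> x = y" "x \<in> carrier G" "y \<in> carrier G" "len x \<le> len y"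
  shows "x \<preceq> y"
  using assms by (metis le_antisym le_len le_len_eq le_refl)

section \<open>Maximal chains below an element\<close>

lemma maxchainD:
  assumes "pred_on.maxchain P (prefix_le G A) C"
  shows "C \<subseteq> P" "x \<in> C \<Longrightarrow> y \<in> C \<Longrightarrow> x \<preceq> y \<or> y \<preceq> x \<or> x = y"
  using assms by (auto simp: pred_on.maxchain_def pred_on.chain_def)

lemma maxchain_maximal:
  assumes "pred_on.maxchain P (prefix_le G A) C"
    and "z \<in> P" "\<And>x. x \<in> C \<Longrightarrow> x \<preceq> z \<or> z \<preceq> x"
  shows "z \<in> C"
proof -
  have "pred_on.chain P (prefix_le G A) (insert z C)"
    using maxchainD[OF assms(1)] assms(2,3) by (auto simp: pred_on.chain_def)
  then show "z \<in> C"
    using assms(1) unfolding pred_on.maxchain_def by blast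
qed

text \<open>Let \<open>x\<close> be the chain element of length \<open>i\<close> and
  \<open>y\<close> a shortest chain element of greater length. Appending to \<open>x\<close> the
  first letter of a reduced word for \<open>inv x \<otimes> y\<close> gives an element between them
  that is comparable with the whole chain, so maximality puts it into the chain.\<close>

lemma maxchain_rank:
  assumes C: "pred_on.maxchain (fact_poset G A g) (prefix_le G A) C"
    and g: "g \<in> carrier G" and i: "i \<le> len g"
  shows "\<exists>z\<in>C. len z = i"
  using i
proof (induction i)
  case 0
  have "\<one> \<in> C"
    using g by (intro maxchain_maximal[OF C]) (use maxchainD(1)[OF C] in \<open>auto simp: fact_poset_iff\<close>)
  then show ?case by force
next
  case (Suc i)
  have car: "x \<in> carrier G" "x \<preceq> g" if "x \<in> C" for x
    using maxchainD(1)[OF C] that by (auto simp: fact_poset_iff)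
  have cmp: "x \<preceq> y" if "x \<in> C" "y \<in> C" "len x \<le> len y" for x y
    using comparable_le maxchainD(2)[OF C] that car by blast
  obtain x where x: "x \<in> C" "len x = i" using Suc by auto
  have "g \<in> C"
    using g by (intro maxchain_maximal[OF C]) (use car in \<open>auto simp: fact_poset_iff\<close>)
  then have "g \<in> C \<and> i < len g" using Suc by simp
  from ex_has_least_nat[of "\<lambda>y. y \<in> C \<and> i < len y", OF this, of len]
  obtain y where y: "y \<in> C" "i < len y" "\<And>s. s \<in> C \<Longrightarrow> i < len s \<Longrightarrow> len y \<le> len s" by blast
  have "x \<preceq> y" using cmp x y by simp
  then obtain w where w: "w \<in> carrier G" "y = x \<otimes> w" "len y = len x + len w"
    using leE car x y by metis
  then have "0 < len w" using x y by simp
  then obtain a w' where a: "a \<in> A" "w' \<in> carrier G" "w = a \<otimes> w'" "len w = Suc (len w')"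
    using first_letter w by blast
  define z where "z = x \<otimes> a"
  have l: "len (x \<otimes> (a \<otimes> w')) = len x + len a + len w'" using w a by simp
  have xc: "x \<in> carrier G" "y \<in> carrier G" "a \<in> carrier G" using car x y a by auto
  have z: "z \<in> carrier G" "z \<preceq> y" "x \<preceq> z" "len z = Suc i"
    using le_mult3[OF xc(1,3) a(2) l] xc a w x by (auto simp: z_def)
  have "z \<in> C"
  proof (rule maxchain_maximal[OF C])
    show "z \<in> fact_poset G A g" using z y car le_trans[of z y g] g by (auto simp: fact_poset_iff)
    fix s assume s: "s \<in> C"
    show "s \<preceq> z \<or> z \<preceq> s"
    proof (cases "i < len s")
      case True
      then have "y \<preceq> s" using cmp y s by blast
      then show ?thesis using le_trans[of z y s] z xc car s by blast
    next
      case False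
      then have "s \<preceq> x" using cmp x s by simp
      then show ?thesis using le_trans[of s x z] z xc car s by blast
    qed
  qed
  then show ?case using z by blast
qed

text \<open>Hausdorff's principle is applied to the elements that are \<open>\<one>\<close> or lie
  above \<open>t\<close>. A maximal chain there contains \<open>t\<close>, and anything comparable
  with \<open>t\<close> is \<open>\<one>\<close> or above \<open>t\<close> by length, so the chain
  is maximal in the whole poset too.\<close>

lemma maxchain_through:
  assumes t: "t \<in> B g" and g: "g \<in> carrier G"
  obtains C where "pred_on.maxchain (fact_poset G A g) (prefix_le G A) C" "t \<in> C"
proof -
  let ?P = "{z \<in> fact_poset G A g. z = \<one> \<or> t \<preceq> z}"
  obtain C where C: "pred_on.maxchain ?P (prefix_le G A) C" using pred_on.Hausdorff by blast
  have t': "t \<in> carrier G" "t \<preceq> g" "t \<in> A" using t by (auto simp: B_iff)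
  have tC: "t \<in> C"
    using t' maxchainD(1)[OF C] by (intro maxchain_maximal[OF C]) (auto simp: fact_poset_iff)
  have "pred_on.maxchain (fact_poset G A g) (prefix_le G A) C"
    unfolding pred_on.maxchain_def
  proof (intro conjI notI)
    show "pred_on.chain (fact_poset G A g) (prefix_le G A) C"
      using C unfolding pred_on.maxchain_def pred_on.chain_def by blast
    assume "\<exists>D. pred_on.chain (fact_poset G A g) (prefix_le G A) D \<and> C \<subset> D"
    then obtain D z where D: "pred_on.chain (fact_poset G A g) (prefix_le G A) D" "C \<subseteq> D"
      and z: "z \<in> D" "z \<notin> C" by blast
    have car: "x \<in> carrier G" if "x \<in> D" for x
      using D that by (auto simp: pred_on.chain_def fact_poset_iff)
    have cmp: "x \<preceq> y \<or> y \<preceq> x" if "x \<in> D" "y \<in> D" for x y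
    proof -
      have "x \<preceq> y \<or> y \<preceq> x \<or> x = y" using D(1) that unfolding pred_on.chain_def by blast
      then show ?thesis using le_refl[OF car[OF that(1)]] by blast
    qed
    have zP: "z \<in> fact_poset G A g" using D z by (auto simp: pred_on.chain_def)
    have "t \<preceq> z \<or> z = \<one>"
    proof (cases "len z = 0")
      case True
      then show ?thesis using len_eq_0[of z] car z by blast
    next
      case False
      then show ?thesis using comparable_le[of t z] cmp[of t z] tC D z t' car by auto
    qed
    then have "z \<in> C" using zP cmp z D by (intro maxchain_maximal[OF C]) auto
    then show False using z by blast
  qed
  then show ?thesis using that tC by blast
qed

text \<open>Connectivity of the hypergraph on \<open>B g\<close> with hyperedges \<open>B k\<close>
  for \<open>k \<in> R g\<close>, phrased through closed subsets so that it can serve directly as an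
  induction principle.\<close>

definition gens_connected :: "'a \<Rightarrow> bool" where
  "gens_connected g \<longleftrightarrow>
     (\<forall>S. S \<subseteq> B g \<and> S \<noteq> {} \<and> (\<forall>k\<in>R g. S \<inter> B k \<noteq> {} \<longrightarrow> B k \<subseteq> S) \<longrightarrow> B g \<subseteq> S)"

text \<open>Passing to an adjacent maximal chain that has a different atom does not change its element of
  rank two, which lies above both atoms.\<close>

lemma chain_connected_imp_gens_connected:
  assumes con: "chain_connected (fact_poset G A g) (prefix_le G A)"
    and g: "g \<in> carrier G" "2 \<le> len g"
  shows "gens_connected g"
  unfolding gens_connected_def
proof (intro allI impI subsetI, elim conjE)
  fix S t assume S: "S \<subseteq> B g" "S \<noteq> {}" "\<forall>k\<in>R g. S \<inter> B k \<noteq> {} \<longrightarrow> B k \<subseteq> S" and t: "t \<in> B g"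
  let ?mc = "pred_on.maxchain (fact_poset G A g) (prefix_le G A)"
  obtain s where s: "s \<in> S" using S by blast
  obtain C where C: "?mc C" "s \<in> C" using maxchain_through S s g by blast
  obtain D where D: "?mc D" "t \<in> D" using maxchain_through t g by blast
  have car: "x \<in> carrier G" "x \<preceq> g" if "?mc E" "x \<in> E" for E x
    using maxchainD(1)[OF that(1)] that(2) by (auto simp: fact_poset_iff)
  have cmp: "x \<preceq> y" if "?mc E" "x \<in> E" "y \<in> E" "len x \<le> len y" for E x y
    using comparable_le maxchainD(2)[OF that(1)] that car by blast
  have unique: "x = y" if "?mc E" "x \<in> E" "y \<in> E" "len x = len y" for E x y
    using cmp[OF that(1-3)] le_len_eq car that by auto
  have move: "\<exists>u\<in>S \<inter> F. len u = 1"
    if E: "?mc E" "u \<in> S" "u \<in> E" "len u = 1" and F: "?mc F" "card (E - F) = 1" for E F u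
  proof -
    obtain v where v: "v \<in> F" "len v = 1" using maxchain_rank[OF F(1) g(1), of 1] g by auto
    obtain k where k: "k \<in> E" "len k = 2" using maxchain_rank[OF E(1) g(1), of 2] g by auto
    show ?thesis
    proof (cases "u \<in> F")
      case False
      have "k \<in> F"
      proof (rule ccontr)
        assume "k \<notin> F"
        then have "{u, k} \<subseteq> E - F" using False k E by blast
        moreover have "finite (E - F)" using F by (simp add: card_eq_0_iff[symmetric] card_ge_0_finite)
        ultimately have "card {u, k} \<le> 1" using F card_mono by metis
        moreover have "u \<noteq> k" using E k by auto
        ultimately show False by simp
      qed
      then have "u \<preceq> k" "v \<preceq> k"
        using cmp[OF E(1) E(3) k(1)] cmp[OF F(1) v(1)] E(4) k(2) v(2) by simp_all
      moreover have "u \<in> A" "v \<in> A"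
        using len_eq_1 car(1)[OF E(1) E(3)] car(1)[OF F(1) v(1)] E(4) v(2) by blast+
      moreover have "k \<in> R g" using car[OF E(1) k(1)] k(2) by (simp add: R_iff)
      ultimately have "u \<in> B k" "v \<in> B k" "k \<in> R g" by (simp_all add: B_iff)
      then show ?thesis using S(3) E(2) v by blast
    qed (use E in blast)
  qed
  have "C \<rightarrow>\<^sup>*\<^bsub>with_proj (mk_symmetric (with_proj (chain_graph (fact_poset G A g) (prefix_le G A))))\<^esub> D"
    using con C(1) D(1) unfolding chain_connected_def connected_def strongly_connected_def
    by (simp add: chain_graph_def)
  then have "?mc D \<and> (\<exists>u\<in>S \<inter> D. len u = 1)"
    unfolding reachable_def
  proof (induction rule: rtrancl_on_induct)
    case base
    then show ?case using C s S by (force simp: B_iff)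
  next
    case (step E F)
    \<comment> \<open>An arc of the symmetrized graph is an arc of \<open>chain_graph\<close> in one
      of the two directions, and \<open>chain_graph\<close> records both differences.\<close>
    then have "?mc E" "?mc F" "card (E - F) = 1"
      by (auto simp: parcs_mk_symmetric chain_graph_def)
    then show ?case using step.IH move by blast
  qed
  then obtain u where "u \<in> S" "u \<in> D" "len u = 1" by blast
  moreover have "len t = 1" using t by (simp add: B_iff)
  ultimately show "t \<in> S" using unique[OF D(1) _ D(2), of u] by simp
qed

section \<open>Reformulating compatibility and covers\<close>

lemma compatible_order_ascent:
  assumes co: "compatible_order G A c r" and c: "c \<in> carrier G"
    and iff: "\<And>x y. x \<in> B c \<Longrightarrow> y \<in> B c \<Longrightarrow> (x, y) \<in> r \<longleftrightarrow> \<rho> x \<le> (\<rho> y :: nat)"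
    and k: "k \<in> R c"
  shows "\<exists>!t. t \<in> B k \<and> \<rho> t \<le> \<rho> (inv t \<otimes> k)"
proof -
  have k': "k \<in> carrier G" "k \<preceq> c" "len k = 2" using k by (auto simp: R_iff)
  have Bk: "B k \<subseteq> B c" using B_mono k' c by blast
  let ?P = "\<lambda>p. [fst p, snd p] \<in> reduced_factorizations G A k \<and> p \<in> r"
  have ex1: "\<exists>!p. ?P p" using co k unfolding compatible_order_def by blast
  have fwd: "fst p \<in> B k \<and> \<rho> (fst p) \<le> \<rho> (inv (fst p) \<otimes> k)" if p: "?P p" for p
  proof -
    have A: "fst p \<in> A" "snd p \<in> A" and e: "fst p \<otimes> snd p = k"
      using p by (auto simp: reduced_factorizations_def)
    note B = B_rank2_mult[OF k'(1,3) A e]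
    have "(fst p, snd p) \<in> r" using p by simp
    then have "\<rho> (fst p) \<le> \<rho> (snd p)" using iff[of "fst p" "snd p"] B Bk by blast
    then show ?thesis using B by simp
  qed
  have bwd: "?P (t, inv t \<otimes> k)" if "t \<in> B k" "\<rho> t \<le> \<rho> (inv t \<otimes> k)" for t
  proof -
    have t: "t \<in> A" "inv t \<otimes> k \<in> A" using that B_rank2 k' by auto
    have "inv t \<otimes> k \<in> B c" using next_B k' that Bk by blast
    then have "(t, inv t \<otimes> k) \<in> r" using iff that Bk by blast
    then show ?thesis using t k' by (auto simp: reduced_factorizations_def)
  qed
  obtain p where p: "?P p" "\<And>p'. ?P p' \<Longrightarrow> p' = p" using ex1 by (elim ex1E) blast
  show ?thesis
  proof (intro ex1I[of _ "fst p"])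
    show "fst p \<in> B k \<and> \<rho> (fst p) \<le> \<rho> (inv (fst p) \<otimes> k)" using fwd p(1) .
    fix t assume "t \<in> B k \<and> \<rho> t \<le> \<rho> (inv t \<otimes> k)"
    then have "(t, inv t \<otimes> k) = p" using bwd p(2) by blast
    then show "t = fst p" by auto
  qed
qed

text \<open>If \<open>h\<close> covers \<open>a\<close>, let \<open>u\<close> be the first letter of
  a reduced word for \<open>inv a \<otimes> h\<close>. Then \<open>a \<otimes> u\<close> lies above
  \<open>a\<close> and below \<open>h\<close>, so it equals \<open>h\<close>. Conversely, length
  leaves no room strictly between lengths one and two.\<close>

lemma covers_gen:
  assumes a: "a \<in> B c" and c: "c \<in> carrier G"
  shows "poset_covers (fact_poset G A c) (prefix_le G A) a h \<longleftrightarrow> (\<exists>u\<in>B (inv a \<otimes> c). h = a \<otimes> u)"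
proof
  have aA: "a \<in> A" "a \<preceq> c" using a by (auto simp: B_iff)
  then have ac: "a \<in> carrier G" by simp
  assume "poset_covers (fact_poset G A c) (prefix_le G A) a h"
  then have h: "h \<in> carrier G" "h \<preceq> c" "a \<preceq> h" "a \<noteq> h"
    and no: "\<And>z. z \<in> carrier G \<Longrightarrow> z \<preceq> c \<Longrightarrow> z \<noteq> a \<Longrightarrow> z \<noteq> h \<Longrightarrow> a \<preceq> z \<Longrightarrow> \<not> z \<preceq> h"
    unfolding poset_covers_def Bex_def fact_poset_iff by blast+
  obtain w where w: "w \<in> carrier G" "h = a \<otimes> w" "len h = len a + len w" using leE[OF h(3) ac h(1)] by blast
  have "w \<noteq> \<one>" using h(4) w ac by auto
  then have "0 < len w" using len_eq_0[OF w(1)] by simp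
  then obtain u w' where u: "u \<in> A" "w' \<in> carrier G" "w = u \<otimes> w'" "len w = Suc (len w')"
    using first_letter w(1) by blast
  obtain y where y: "y \<in> carrier G" "c = h \<otimes> y" "len c = len h + len y" using leE[OF h(2,1) c] by blast
  have uc: "u \<in> carrier G" using u by simp
  have l: "len (a \<otimes> (u \<otimes> w')) = len a + len u + len w'"
    using w(2,3) u by simp
  note m = le_mult3[OF ac uc u(2) l]
  have auh: "a \<otimes> u \<preceq> h" using m(4) w(2) u(3) by simp
  have auc: "a \<otimes> u \<in> carrier G" using ac uc by simp
  have "a \<otimes> u \<noteq> a"
  proof
    assume "a \<otimes> u = a"
    then have "len u = 0" using m(1) by simp
    then show False using u by simp
  qed
  then have e: "h = a \<otimes> u"
    using no[OF auc le_trans[OF auh h(2) auc h(1) c]] m(5) auh by blast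
  have d: "inv a \<otimes> c = u \<otimes> y" using y e ac uc by (simp add: m_assoc)
  have "len (inv a \<otimes> c) = len u + len y"
    using aA(2) y(3) m(1) unfolding prefix_le_def e by simp
  then have "u \<in> B (inv a \<otimes> c)" unfolding d using le_mult_iff[OF uc y(1)] u by (simp add: B_iff)
  then show "\<exists>u\<in>B (inv a \<otimes> c). h = a \<otimes> u" using e by blast
next
  have aA: "a \<in> A" "a \<preceq> c" using a by (auto simp: B_iff)
  then have ac: "a \<in> carrier G" by simp
  assume "\<exists>u\<in>B (inv a \<otimes> c). h = a \<otimes> u"
  then obtain u where u: "u \<in> B (inv a \<otimes> c)" "h = a \<otimes> u" by blast
  then have uA: "u \<in> A" by (simp add: B_iff)
  have h: "h \<in> carrier G" "h \<preceq> c" "len h = 2" using pair_in_R[OF a u(1) c] u(2) by (auto simp: R_iff)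
  have ah: "a \<preceq> h" using le_mult_iff[of a u] h(3) ac uA len_gen[OF aA(1)] unfolding u(2) by simp
  have "\<not> (\<exists>z\<in>fact_poset G A c. z \<noteq> a \<and> z \<noteq> h \<and> a \<preceq> z \<and> z \<preceq> h)"
  proof
    assume "\<exists>z\<in>fact_poset G A c. z \<noteq> a \<and> z \<noteq> h \<and> a \<preceq> z \<and> z \<preceq> h"
    then obtain z where z: "z \<in> carrier G" "z \<noteq> a" "z \<noteq> h" "a \<preceq> z" "z \<preceq> h"
      by (auto simp: fact_poset_iff)
    have "len a = len z \<or> len z = len h" using le_len[OF z(4)] le_len[OF z(5)] h(3) aA by auto
    then show False using le_len_eq z ac h by metis
  qed
  moreover have "a \<noteq> h" using h(3) aA by auto
  ultimately show "poset_covers (fact_poset G A c) (prefix_le G A) a h"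
    using h ac aA ah unfolding poset_covers_def fact_poset_iff by blast
qed

lemma totally_chain_connected_below:
  assumes "totally_chain_connected (fact_poset G A c) (prefix_le G A)" "c \<in> carrier G"
    and g: "g \<in> carrier G" "g \<preceq> c" "2 \<le> len g"
  shows "gens_connected g"
proof (rule chain_connected_imp_gens_connected[OF _ g(1,3)])
  have "\<one> \<in> fact_poset G A c" "g \<in> fact_poset G A c" "\<one> \<preceq> g"
    using assms by (auto simp: fact_poset_iff)
  then show "chain_connected (fact_poset G A g) (prefix_le G A)"
    using assms(1) fact_poset_interval[OF g(1,2) assms(2)] unfolding totally_chain_connected_def by metis
qed

end


section \<open>Cyclic order of the generators below a rank two element\<close>

text \<open>The strict cyclic order: going down from \<open>x\<close>, and jumping from the bottom
  to the top, one meets \<open>y\<close> before \<open>z\<close>. The descending orientation is the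
  one in which the cycles of rank two elements run.\<close>

definition cyc :: "nat \<Rightarrow> nat \<Rightarrow> nat \<Rightarrow> bool" where
  "cyc x y z \<longleftrightarrow> x > y \<and> y > z \<or> y > z \<and> z > x \<or> z > x \<and> x > y"

lemma cyc_rotate: "cyc x y z \<Longrightarrow> cyc y z x"
  unfolding cyc_def by auto

lemma cyc_trans: "cyc x y z \<Longrightarrow> cyc x z w \<Longrightarrow> cyc x y w"
  unfolding cyc_def by auto

lemma cyc_rotate': "cyc x y z \<Longrightarrow> cyc z x y"
  by (rule cyc_rotate[OF cyc_rotate])

text \<open>The hypotheses place the four points in the circular order \<open>a\<close>,
  \<open>p\<close>, \<open>q\<close>, \<open>r\<close>.\<close>

lemma cyc_outside:
  assumes "cyc p q r" "cyc a p r"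
  shows "cyc a p q" "cyc q r a"
  using cyc_rotate'[OF cyc_trans[OF assms(1) cyc_rotate[OF assms(2)]]]
    cyc_rotate'[OF cyc_trans[OF cyc_rotate'[OF assms(2)] cyc_rotate'[OF assms(1)]]] by blast+

text \<open>The hypotheses place the four points in the circular order \<open>a\<close>,
  \<open>p\<close>, \<open>f\<close>, \<open>q\<close>.\<close>

lemma cyc_join:
  assumes "cyc a p q" "cyc f q p"
  shows "cyc a p f" "cyc f q a"
  using cyc_rotate'[OF cyc_trans[OF cyc_rotate'[OF assms(2)] cyc_rotate[OF assms(1)]]]
    cyc_rotate'[OF cyc_trans[OF cyc_rotate'[OF assms(1)] cyc_rotate[OF assms(2)]]] by blast+

text \<open>The way down from \<open>x\<close> to \<open>y\<close> around a circle of length \<open>N\<close>; it is a full turn if \<open>x = y\<close>.\<close>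

definition arc :: "nat \<Rightarrow> nat \<Rightarrow> nat \<Rightarrow> nat" where
  "arc N x y = (if y < x then x - y else x + N - y)"

lemma cyc_total: "x \<noteq> y \<Longrightarrow> y \<noteq> z \<Longrightarrow> x \<noteq> z \<Longrightarrow> cyc x y z \<or> cyc x z y"
  unfolding cyc_def by auto

text \<open>The circular order is \<open>v\<close>, \<open>b\<close>, \<open>x\<close>,
  \<open>u\<close>, where \<open>u\<close> may coincide with \<open>x\<close>. So the arc from
  \<open>v\<close> to \<open>u\<close> contains the one from \<open>b\<close> to \<open>x\<close>,
  strictly because \<open>v \<noteq> b\<close>.\<close>

lemma arc_less_arc:
  assumes "\<not> cyc b v x" "\<not> cyc u x v" "b \<noteq> x" "v \<noteq> b" "v \<noteq> x" "u \<noteq> v"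
    and "b < N" "x < N" "u < N" "v < N"
  shows "arc N b x < arc N v u"
proof -
  have "b > x \<and> x > v \<or> x > v \<and> v > b \<or> v > b \<and> b > x"
    using cyc_total[of b v x] assms unfolding cyc_def by blast
  moreover have "u = x \<or> u > v \<and> v > x \<or> v > x \<and> x > u \<or> x > u \<and> u > v"
    using cyc_total[of u x v] assms unfolding cyc_def by blast
  ultimately show ?thesis
    using assms(7-) unfolding arc_def by (elim disjE conjE) simp_all
qed

lemma cyc_arc_less:
  assumes "cyc q s t" "q < N" "s < N" "t < N"
  shows "arc N t q < arc N s q"
  using assms unfolding cyc_def arc_def by auto

lemma no_infinite_descent: "(\<And>j. f (Suc j) < (f j :: nat)) \<Longrightarrow> False"
proof -
  assume f: "\<And>j. f (Suc j) < f j"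
  have "f j + j \<le> f 0" for j
  proof (induction j)
    case (Suc j)
    then show ?case using f[of j] by simp
  qed simp
  from this[of "Suc (f 0)"] show False by simp
qed

lemma linear_order_rank:
  assumes lin: "linear_order_on S r" and fin: "finite S"
  obtains \<rho> :: "'a \<Rightarrow> nat" where "inj_on \<rho> S"
    "\<And>x y. x \<in> S \<Longrightarrow> y \<in> S \<Longrightarrow> (x, y) \<in> r \<longleftrightarrow> \<rho> x \<le> \<rho> y"
proof -
  define \<rho> where "\<rho> x = card {y. (y, x) \<in> r}" for x
  have r: "r \<subseteq> S \<times> S" "refl_on S r" "trans r" "antisym r" "total_on S r"
    using lin by (auto simp: order_on_defs)
  have f: "finite {y. (y, x) \<in> r}" for x
    by (rule finite_subset[OF _ fin]) (use r(1) in blast)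
  have mono: "\<rho> x \<le> \<rho> y" if "(x, y) \<in> r" for x y
    unfolding \<rho>_def by (rule card_mono[OF f]) (use that r(3) in \<open>auto dest: transD\<close>)
  have strict: "\<rho> x < \<rho> y" if "(x, y) \<in> r" "x \<noteq> y" for x y
    unfolding \<rho>_def
  proof (rule psubset_card_mono[OF f])
    have "(y, y) \<in> r" using that r(1,2) by (auto simp: refl_on_def)
    moreover have "(y, x) \<notin> r" using that r(4) by (auto dest: antisymD)
    ultimately show "{z. (z, x) \<in> r} \<subset> {z. (z, y) \<in> r}" using that r(3) by (auto dest: transD)
  qed
  have iff: "(x, y) \<in> r \<longleftrightarrow> \<rho> x \<le> \<rho> y" if xy: "x \<in> S" "y \<in> S" for x y
  proof
    assume le: "\<rho> x \<le> \<rho> y"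
    show "(x, y) \<in> r"
    proof (cases "x = y")
      case False
      then have "(x, y) \<in> r \<or> (y, x) \<in> r" using r(5) xy by (auto simp: total_on_def)
      then show ?thesis using strict[of y x] le False by auto
    qed (use xy r(2) in \<open>auto simp: refl_on_def\<close>)
  qed (rule mono)
  have "inj_on \<rho> S"
  proof (rule inj_onI)
    fix x y assume "x \<in> S" "y \<in> S" "\<rho> x = \<rho> y"
    then have "(x, y) \<in> r" "(y, x) \<in> r" using iff by simp_all
    then show "x = y" using r(4) by (blast dest: antisymD)
  qed
  then show ?thesis using that iff by blast
qed


text \<open>The working form of the hypotheses: \<open>\<rho>\<close> numbers the generators along
  the order, \<open>unique_ascent\<close> expresses compatibility, and
  \<open>connected_below\<close> is what total chain-connectedness provides for intervals starting
  at \<open>\<one>\<close>.\<close>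

locale compatible_rank = generated_group +
  fixes c :: 'a and \<rho> :: "'a \<Rightarrow> nat"
  assumes c_closed [simp]: "c \<in> carrier G"
    and finite_B: "finite (B c)"
    and inj_rank: "inj_on \<rho> (B c)"
    and unique_ascent: "k \<in> R c \<Longrightarrow> \<exists>!t. t \<in> B k \<and> \<rho> t \<le> \<rho> (inv t \<otimes> k)"
    and connected_below: "g \<in> carrier G \<Longrightarrow> g \<preceq> c \<Longrightarrow> 2 \<le> len g \<Longrightarrow> gens_connected g"
begin

lemma R_c:
  assumes "k \<in> R c"
  shows "k \<in> carrier G" "len k = 2" "k \<preceq> c" "finite (B k)" "B k \<subseteq> B c"
proof -
  show k: "k \<in> carrier G" "len k = 2" "k \<preceq> c" using assms by (auto simp: R_iff)
  show "B k \<subseteq> B c" using B_mono k by simp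
  then show "finite (B k)" using finite_B finite_subset by blast
qed

lemma rank_eq: "s \<in> B c \<Longrightarrow> t \<in> B c \<Longrightarrow> \<rho> s = \<rho> t \<Longrightarrow> s = t"
  using inj_rank by (auto dest: inj_onD)

lemma ascent_unique:
  "k \<in> R c \<Longrightarrow> s \<in> B k \<Longrightarrow> t \<in> B k \<Longrightarrow> \<rho> s \<le> \<rho> (inv s \<otimes> k) \<Longrightarrow> \<rho> t \<le> \<rho> (inv t \<otimes> k) \<Longrightarrow> s = t"
  using unique_ascent by blast

section \<open>Consequences of the unique ascent\<close>

lemma max_rank:
  assumes "k \<in> R c" "t \<in> B k"
  obtains m where "m \<in> B k" "\<And>s. s \<in> B k \<Longrightarrow> \<rho> s \<le> \<rho> m"
proof -
  have "Max (\<rho> ` B k) \<in> \<rho> ` B k" using R_c(4)[OF assms(1)] assms by (intro Max_in) auto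
  then obtain m where "m \<in> B k" "Max (\<rho> ` B k) = \<rho> m" by auto
  then show ?thesis using that[of m] R_c(4)[OF assms(1)] by (metis Max_ge finite_imageI imageI)
qed

text \<open>The predecessor of a generator of maximal rank is an ascent, so by uniqueness it is
  \<open>t\<close>.\<close>

lemma ascent_next_max:
  assumes k: "k \<in> R c" and t: "t \<in> B k" "\<rho> t \<le> \<rho> (inv t \<otimes> k)" and s: "s \<in> B k"
  shows "\<rho> s \<le> \<rho> (inv t \<otimes> k)"
proof -
  obtain m where m: "m \<in> B k" "\<And>s. s \<in> B k \<Longrightarrow> \<rho> s \<le> \<rho> m" using max_rank k t by blast
  obtain p where p: "p \<in> B k" "inv p \<otimes> k = m" using prev_B[OF R_c(1,2)[OF k] m(1)] by blast
  then have "p = t" using ascent_unique[OF k p(1) t(1)] t m by blast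
  then show ?thesis using p m s by simp
qed

text \<open>A generator of least rank in \<open>B k\<close> is an ascent, so it is
  \<open>t\<close>.\<close>

lemma ascent_min:
  assumes k: "k \<in> R c" and t: "t \<in> B k" "\<rho> t \<le> \<rho> (inv t \<otimes> k)" and s: "s \<in> B k"
  shows "\<rho> t \<le> \<rho> s"
proof -
  obtain m where m: "m \<in> B k" "\<And>s. s \<in> B k \<Longrightarrow> \<rho> m \<le> \<rho> s"
    using t ex_has_least_nat[of "\<lambda>s. s \<in> B k" t \<rho>] by blast
  then have "\<rho> m \<le> \<rho> (inv m \<otimes> k)" using next_B[OF R_c(1,2)[OF k] m(1)] by blast
  then have "m = t" using ascent_unique[OF k m(1) t(1)] t(2) by blast
  then show ?thesis using m s by simp
qed

text \<open>If \<open>s\<close> is a counterexample of maximal rank, then its predecessor in the cycle cannot lie in the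
  gap below \<open>t\<close>, and it has larger rank than \<open>s\<close> because \<open>s\<close> is not the maximum. So \<open>t\<close> lies in the gap
  below the predecessor of \<open>s\<close>.\<close>

lemma descent_gap:
  assumes k: "k \<in> R c" and "t \<in> B k" "s \<in> B k" "\<rho> (inv t \<otimes> k) < \<rho> s" "\<rho> s < \<rho> t"
  shows False
  using assms(2-)
proof -
  obtain m where m: "m \<in> B k" "\<And>s. s \<in> B k \<Longrightarrow> \<rho> s \<le> \<rho> m" using max_rank k assms by blast
  from assms(2-) show False
  proof (induction "\<rho> m - \<rho> t" arbitrary: s t rule: less_induct)
    case less
    let ?P = "\<lambda>s. s \<in> B k \<and> \<rho> (inv t \<otimes> k) < \<rho> s \<and> \<rho> s < \<rho> t"
    obtain s where s: "?P s" and smax: "\<And>s'. ?P s' \<Longrightarrow> \<rho> s' \<le> \<rho> s"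
      using ex_has_greatest_nat[of ?P s \<rho> "\<rho> t"] less.prems by blast
    obtain p where p: "p \<in> B k" "inv p \<otimes> k = s" using prev_B[OF R_c(1,2)[OF k]] s by blast
    have "\<rho> s < \<rho> p"
    proof (rule ccontr)
      assume "\<not> \<rho> s < \<rho> p"
      then have "\<rho> m \<le> \<rho> s" using ascent_next_max[OF k p(1), of m] p m by simp
      then show False using s m(2)[of t] less.prems by simp
    qed
    moreover have "p \<noteq> t" using p s by auto
    then have "\<rho> p \<noteq> \<rho> t" using rank_eq p less.prems R_c(5)[OF k] by blast
    ultimately have "\<rho> t < \<rho> p" using smax[of p] p s by force
    moreover have "\<rho> p \<le> \<rho> m" using m(2) p by blast
    ultimately have "\<rho> m - \<rho> p < \<rho> m - \<rho> t" by linarith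
    then show False
      using less.hyps[of p t] p less.prems s \<open>\<rho> t < \<rho> p\<close> by simp
  qed
qed

text \<open>The rotation-invariant summary of the preceding lemmas: the unique ascent is the jump
  from the minimum to the maximum, so it leaves no gap on the circle, and neither does any
  descent.\<close>

lemma cyclic_gap:
  assumes k: "k \<in> R c" and t: "t \<in> B k" and s: "s \<in> B k"
  shows "\<not> cyc (\<rho> t) (\<rho> s) (\<rho> (inv t \<otimes> k))"
proof (cases "\<rho> t \<le> \<rho> (inv t \<otimes> k)")
  case True
  then show ?thesis
    using ascent_min[OF k t True s] ascent_next_max[OF k t True s] by (auto simp: cyc_def)
next
  case False
  then show ?thesis using descent_gap[OF k t s] by (auto simp: cyc_def)
qed

text \<open>An element of least rank in a nonempty invariant set is an ascent. By finiteness the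
  successor map permutes \<open>C\<close>, so the complement of \<open>C\<close> is invariant as
  well, and if nonempty it would supply a second ascent.\<close>

lemma single_cycle:
  assumes k: "k \<in> R c" and C: "C \<subseteq> B k" "C \<noteq> {}"
    and closed: "\<And>t. t \<in> C \<Longrightarrow> inv t \<otimes> k \<in> C"
  shows "B k = C"
proof (rule ccontr)
  assume "B k \<noteq> C"
  have asc: "\<exists>t\<in>D. \<rho> t \<le> \<rho> (inv t \<otimes> k)"
    if D: "D \<noteq> {}" "\<And>t. t \<in> D \<Longrightarrow> inv t \<otimes> k \<in> D" for D
  proof -
    obtain d where "d \<in> D" using D by blast
    from ex_has_least_nat[of "\<lambda>t. t \<in> D", OF this, of \<rho>] show ?thesis using D(2) by blast
  qed
  have inj: "inj_on (\<lambda>t. inv t \<otimes> k) (B k)"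
    using R_c[OF k] by (intro inj_onI) (metis B_iff gen_closed next_inj)
  have "finite C" using C R_c[OF k] finite_subset by blast
  then have C_img: "(\<lambda>t. inv t \<otimes> k) ` C = C"
    using closed inj_on_subset[OF inj C(1)] by (intro endo_inj_surj) auto
  have "inv t \<otimes> k \<in> B k - C" if t: "t \<in> B k - C" for t
  proof
    show "inv t \<otimes> k \<in> B k" using next_B R_c[OF k] t by blast
    show "inv t \<otimes> k \<notin> C"
    proof
      assume "inv t \<otimes> k \<in> C"
      then have "inv t \<otimes> k \<in> (\<lambda>t. inv t \<otimes> k) ` C" unfolding C_img .
      then obtain u where "u \<in> C" "inv t \<otimes> k = inv u \<otimes> k" by blast
      then show False using inj_onD[OF inj] t C by blast
    qed
  qed
  then obtain t where "t \<in> B k - C" "\<rho> t \<le> \<rho> (inv t \<otimes> k)"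
    using asc[of "B k - C"] C \<open>B k \<noteq> C\<close> by blast
  moreover obtain u where "u \<in> C" "\<rho> u \<le> \<rho> (inv u \<otimes> k)" using asc[of C] C closed by blast
  ultimately show False using ascent_unique[OF k, of t u] C by blast
qed

text \<open>The three generators are closed under the successor map, so they fill
  \<open>B (x \<otimes> y)\<close>. At most one of the three steps ascends, which fixes their
  circular orientation.\<close>

lemma triangle:
  assumes k: "x \<otimes> y \<in> R c" and xyz: "x \<in> A" "y \<in> A" "z \<in> A"
    and eq: "y \<otimes> z = x \<otimes> y" "z \<otimes> x = x \<otimes> y" and ne: "x \<noteq> y"
  shows "B (x \<otimes> y) = {x, y, z}" "cyc (\<rho> x) (\<rho> y) (\<rho> z)"
proof -
  let ?k = "x \<otimes> y"
  note k' = R_c[OF k]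
  note xy = B_rank2_mult[OF k'(1,2) xyz(1,2) refl]
  note yz = B_rank2_mult[OF k'(1,2) xyz(2,3) eq(1)]
  note zx = B_rank2_mult[OF k'(1,2) xyz(3,1) eq(2)]
  show "B (x \<otimes> y) = {x, y, z}"
    using xy yz zx by (intro single_cycle[OF k]) auto
  have "y \<noteq> z" using eq(1) ne xyz right_cancel[of y y x] by auto
  moreover have "z \<noteq> x" using eq(2) ne xyz Units_l_cancel[of x x y] by auto
  ultimately have "\<not> (\<rho> x \<le> \<rho> y \<and> \<rho> y \<le> \<rho> z)" "\<not> (\<rho> x \<le> \<rho> y \<and> \<rho> z \<le> \<rho> x)" "\<not> (\<rho> y \<le> \<rho> z \<and> \<rho> z \<le> \<rho> x)"
    using ascent_unique[OF k, of x y] ascent_unique[OF k, of x z] ascent_unique[OF k, of y z] xy yz zx ne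
    by auto
  then show "cyc (\<rho> x) (\<rho> y) (\<rho> z)" unfolding cyc_def by linarith
qed

lemma commuting_pair:
  assumes "x \<otimes> y \<in> R c" "x \<in> A" "y \<in> A" "y \<otimes> x = x \<otimes> y"
  shows "B (x \<otimes> y) = {x, y}"
  using assms R_c[OF assms(1)] B_rank2_mult[of "x \<otimes> y" x y] B_rank2_mult[of "x \<otimes> y" y x]
  by (intro single_cycle) auto

lemma square:
  assumes "x \<otimes> x \<in> R c" "x \<in> A"
  shows "B (x \<otimes> x) = {x}"
  using commuting_pair[of x x] assms by simp


section \<open>Generators below longer elements\<close>

lemma R_below: "g \<preceq> c \<Longrightarrow> g \<in> carrier G \<Longrightarrow> R g \<subseteq> R c"
  using R_mono by simp

lemma B_below: "g \<preceq> c \<Longrightarrow> g \<in> carrier G \<Longrightarrow> B g \<subseteq> B c"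
  using B_mono by simp

text \<open>The method for computing \<open>B g\<close>: start with one generator and, for each
  \<open>t\<close> found, adjoin the cycles of all \<open>t \<otimes> u\<close> with
  \<open>u\<close> below the shorter element \<open>inv t \<otimes> g\<close>. Connectivity ensures
  that this reaches every generator.\<close>

lemma B_closure:
  assumes g: "g \<in> carrier G" "g \<preceq> c" "2 \<le> len g" and S: "s \<in> S" "s \<in> B g"
    and closed: "\<And>t u. t \<in> S \<Longrightarrow> t \<in> B g \<Longrightarrow> u \<in> B (inv t \<otimes> g) \<Longrightarrow> B (t \<otimes> u) \<subseteq> S"
  shows "B g \<subseteq> S"
proof -
  have "B k \<subseteq> S \<inter> B g" if k: "k \<in> R g" "t \<in> S \<inter> B g" "t \<in> B k" for k t
  proof -
    have kg: "k \<in> carrier G" "k \<preceq> g" "len k = 2" using k by (auto simp: R_iff)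
    have u: "t \<in> A" "inv t \<otimes> k \<in> A" using k kg B_rank2 by auto
    obtain v where v: "v \<in> carrier G" "g = k \<otimes> v" "len g = len k + len v" using leE[OF kg(2,1) g(1)] by blast
    have "inv t \<otimes> g = (inv t \<otimes> k) \<otimes> v" using v u kg by (simp add: m_assoc)
    moreover have "len (inv t \<otimes> g) = 1 + len v"
    proof -
      have "t \<preceq> g" using k by (simp add: B_iff)
      then show ?thesis using v(3) kg(3) len_gen[OF u(1)] unfolding prefix_le_def by linarith
    qed
    ultimately have "inv t \<otimes> k \<preceq> inv t \<otimes> g"
      using le_mult_iff[of "inv t \<otimes> k" v] u v by simp
    then have "inv t \<otimes> k \<in> B (inv t \<otimes> g)" using u(2) by (simp add: B_iff)
    then have "B (t \<otimes> (inv t \<otimes> k)) \<subseteq> S" using closed[of t] k(2) by blast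
    moreover have "t \<otimes> (inv t \<otimes> k) = k" using u(1) kg(1) by simp
    moreover have "B k \<subseteq> B g" using B_mono[OF kg(2,1) g(1)] .
    ultimately show ?thesis by simp
  qed
  then show ?thesis
    using connected_below[OF g] S unfolding gens_connected_def by blast
qed

lemma suffix_below:
  assumes "t \<in> B g" "g \<in> carrier G" "g \<preceq> c"
  shows "inv t \<otimes> g \<in> carrier G" "inv t \<otimes> g \<preceq> c" "inv t \<otimes> g \<preceq> g" "len g = Suc (len (inv t \<otimes> g))"
proof -
  have t: "t \<in> A" "t \<preceq> g" using assms by (auto simp: B_iff)
  show 1: "inv t \<otimes> g \<in> carrier G" "inv t \<otimes> g \<preceq> g" using t assms(2) suffix_le'[of t g] by simp_all
  then show "inv t \<otimes> g \<preceq> c" using le_trans[of _ g c] assms by simp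
  show "len g = Suc (len (inv t \<otimes> g))" using t len_gen[OF t(1)] unfolding prefix_le_def by linarith
qed

lemma len_power_le: "x \<in> A \<Longrightarrow> len (x [^] (n::nat)) \<le> n"
proof (induction n)
  case (Suc n)
  then show ?case using len_mult_le[of "x [^] n" x] by simp
qed simp

text \<open>By induction \<open>x\<close> is the only generator below the suffix, and the cycle of
  \<open>x \<otimes> x\<close> is a loop, so the closure never leaves \<open>{x}\<close>.\<close>

lemma B_power:
  assumes x: "x \<in> A" and "x [^] n \<preceq> c" "len (x [^] n) = n" "0 < n"
  shows "B (x [^] n) = {x}"
  using assms(2-)
proof (induction n)
  case (Suc n)
  have xc: "x \<in> carrier G" using x by simp
  have e: "x [^] Suc n = x \<otimes> x [^] n" by (rule nat_pow_Suc2[OF xc])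
  have "len (x \<otimes> x [^] n) \<le> 1 + len (x [^] n)"
    using len_mult_le[OF xc nat_pow_closed[OF xc], of n] x by simp
  then have l: "len (x [^] n) = n" using Suc.prems(2) len_power_le[OF x, of n] unfolding e by linarith
  have xB: "x \<in> B (x [^] Suc n)"
    unfolding B_iff e using le_mult_iff[OF xc nat_pow_closed[OF xc], of n] Suc.prems(2) l x
    unfolding e by simp
  have i: "inv x \<otimes> x [^] Suc n = x [^] n" unfolding e using xc by simp
  have c: "x [^] Suc n \<in> carrier G" using xc by (rule nat_pow_closed)
  note suf = suffix_below[OF xB c Suc.prems(1)]
  show ?case
  proof (cases "n = 0")
    case True
    then show ?thesis using xc B_gen[OF x] by simp
  next
    case False
    have IH: "B (x [^] n) = {x}" using Suc.IH suf(2) l False unfolding i by blast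
    have "x \<otimes> x \<in> R (x [^] Suc n)" using pair_in_R[OF xB, of x] c IH unfolding i by blast
    then have "x \<otimes> x \<in> R c" using R_below[OF Suc.prems(1) c] by blast
    then have sq: "B (x \<otimes> x) = {x}" using square x by blast
    have "B (x [^] Suc n) \<subseteq> {x}"
    proof (rule B_closure[OF c Suc.prems(1) _ _ xB])
      show "2 \<le> len (x [^] Suc n)" using Suc.prems(2) False by linarith
      show "B (t \<otimes> u) \<subseteq> {x}" if "t \<in> {x}" "u \<in> B (inv t \<otimes> x [^] Suc n)" for t u
        using that i IH sq by auto
    qed simp
    then show ?thesis using xB by blast
  qed
qed simp


section \<open>Separated elements\<close>

definition separated :: "'a \<Rightarrow> bool" where
  "separated g \<longleftrightarrow> (\<forall>x\<in>B g. \<forall>y\<in>B g. \<rho> y < \<rho> x \<longrightarrow>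
     (\<exists>k\<in>R g. x \<in> B k \<and> y \<in> B k) \<or> (\<exists>z\<in>B g. \<rho> y < \<rho> z \<and> \<rho> z < \<rho> x))"

text \<open>Edges of the reduced graph strictly lower the rank, which gives antisymmetry. Totality
  is an induction on the rank difference: a generator in between splits the path, and otherwise a
  common upper cover yields an edge.\<close>

lemma separated_imp_linear:
  assumes g: "g \<in> carrier G" "g \<preceq> c" and sep: "separated g"
    and r: "\<And>x y. x \<in> B c \<Longrightarrow> y \<in> B c \<Longrightarrow> (x, y) \<in> r \<longleftrightarrow> \<rho> x \<le> \<rho> y"
  shows "induces_linear_order (reduced_cycle_graph G A g (r \<inter> B g \<times> B g))"
proof -
  define D where "D = reduced_cycle_graph G A g (r \<inter> B g \<times> B g)"
  have sub: "B g \<subseteq> B c" using B_below g by blast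
  have verts: "verts D = B g" by (simp add: D_def reduced_cycle_graph_def cycle_graph_def)
  have edge: "(x, y) \<in> arcs_ends D \<longleftrightarrow> x \<in> B g \<and> y \<in> B g \<and> x \<otimes> y \<in> R g \<and> \<rho> y < \<rho> x" for x y
  proof -
    have "(x, y) \<in> arcs_ends D \<longleftrightarrow> x \<in> B g \<and> y \<in> B g \<and> x \<otimes> y \<in> R g \<and> (x, y) \<notin> r"
      by (force simp: D_def reduced_cycle_graph_def cycle_graph_def arcs_ends_def arc_to_ends_def)
    moreover have "(x, y) \<in> r \<longleftrightarrow> \<rho> x \<le> \<rho> y" if "x \<in> B g" "y \<in> B g"
      using r[of x y] sub that by blast
    ultimately show ?thesis by auto
  qed
  have refl: "x \<rightarrow>\<^sup>*\<^bsub>D\<^esub> x" if "x \<in> B g" for x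
    using that by (simp add: reachable_def verts)
  have trans: "x \<rightarrow>\<^sup>*\<^bsub>D\<^esub> z" if "x \<rightarrow>\<^sup>*\<^bsub>D\<^esub> y" "y \<rightarrow>\<^sup>*\<^bsub>D\<^esub> z" for x y z
    using that unfolding reachable_def by (rule rtrancl_on_trans)
  have arc: "x \<rightarrow>\<^sup>*\<^bsub>D\<^esub> y" if "(x, y) \<in> arcs_ends D" for x y
    using that refl[of x] edge[of x y] unfolding reachable_def verts
    by (blast intro: rtrancl_on_into_rtrancl_on)
  have down: "x \<in> B g \<and> y \<in> B g \<and> \<rho> y \<le> \<rho> x" if "x \<rightarrow>\<^sup>*\<^bsub>D\<^esub> y" for x y
    using that unfolding reachable_def verts
    by (induction rule: rtrancl_on_induct) (use edge in force)+
  have reach: "x \<rightarrow>\<^sup>*\<^bsub>D\<^esub> y" if "x \<in> B g" "y \<in> B g" "\<rho> y < \<rho> x" for x y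
    using that
  proof (induction "\<rho> x - \<rho> y" arbitrary: x y rule: less_induct)
    case less
    show ?case
    proof (cases "\<exists>z\<in>B g. \<rho> y < \<rho> z \<and> \<rho> z < \<rho> x")
      case True
      then obtain z where z: "z \<in> B g" "\<rho> y < \<rho> z" "\<rho> z < \<rho> x" by blast
      have "x \<rightarrow>\<^sup>*\<^bsub>D\<^esub> z" "z \<rightarrow>\<^sup>*\<^bsub>D\<^esub> y" using less z by simp_all
      then show ?thesis using trans by blast
    next
      case False
      then obtain k where k: "k \<in> R g" "x \<in> B k" "y \<in> B k"
        using sep less.prems unfolding separated_def by blast
      have kc: "k \<in> R c" using k R_below g by blast
      let ?n = "inv x \<otimes> k"
      have kg: "k \<in> carrier G" "k \<preceq> g" "len k = 2" using k by (auto simp: R_iff)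
      have n: "?n \<in> B k" using next_B kg k by blast
      have nB: "?n \<in> B g" using n B_mono kg g by blast
      \<comment> \<open>Since \<open>y\<close> has smaller rank, \<open>x\<close> is not the ascent
        of \<open>k\<close>, so the cycle descends from \<open>x\<close> to \<open>?n\<close>. By
        \<open>descent_gap\<close>, \<open>y\<close> is not skipped, and no rank lies strictly
        between, so \<open>?n\<close> is \<open>y\<close>.\<close>
      have "\<rho> ?n < \<rho> x" using ascent_min[OF kc k(2) _ k(3)] less.prems by force
      moreover have "\<rho> y \<le> \<rho> ?n" using descent_gap[OF kc k(2,3)] less.prems by force
      ultimately have "\<rho> ?n = \<rho> y" using False nB by force
      then have "?n = y" using rank_eq nB less.prems sub by blast
      then have "x \<otimes> y = k" using k kg by (auto simp: B_iff)
      then show ?thesis using arc edge less.prems k by simp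
    qed
  qed
  have "linear_order_on (B g) {(u, v). u \<rightarrow>\<^sup>*\<^bsub>D\<^esub> v}"
    unfolding order_on_defs
  proof (intro conjI)
    show "{(u, v). u \<rightarrow>\<^sup>*\<^bsub>D\<^esub> v} \<subseteq> B g \<times> B g" using down by blast
    show "refl_on (B g) {(u, v). u \<rightarrow>\<^sup>*\<^bsub>D\<^esub> v}" using refl by (simp add: refl_on_def)
    show "trans {(u, v). u \<rightarrow>\<^sup>*\<^bsub>D\<^esub> v}" using trans by (auto intro!: transI)
    show "antisym {(u, v). u \<rightarrow>\<^sup>*\<^bsub>D\<^esub> v}"
    proof (rule antisymI)
      fix x y assume "(x, y) \<in> {(u, v). u \<rightarrow>\<^sup>*\<^bsub>D\<^esub> v}" "(y, x) \<in> {(u, v). u \<rightarrow>\<^sup>*\<^bsub>D\<^esub> v}"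
      then have "x \<in> B g" "y \<in> B g" "\<rho> x = \<rho> y" using down[of x y] down[of y x] by auto
      then show "x = y" using rank_eq sub by blast
    qed
    show "total_on (B g) {(u, v). u \<rightarrow>\<^sup>*\<^bsub>D\<^esub> v}"
    proof (rule total_onI)
      fix x y assume xy: "x \<in> B g" "y \<in> B g" "x \<noteq> y"
      then have "\<rho> x \<noteq> \<rho> y" using rank_eq sub by blast
      then show "(x, y) \<in> {(u, v). u \<rightarrow>\<^sup>*\<^bsub>D\<^esub> v} \<or> (y, x) \<in> {(u, v). u \<rightarrow>\<^sup>*\<^bsub>D\<^esub> v}"
        using reach[of x y] reach[of y x] xy by (cases "\<rho> x < \<rho> y") simp_all
    qed
  qed
  then show ?thesis unfolding induces_linear_order_def D_def[symmetric] verts .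
qed

lemma separated_rank_le_2:
  assumes g: "g \<in> carrier G" "len g \<le> 2"
  shows "separated g"
  unfolding separated_def
proof (intro ballI impI)
  fix x y assume xy: "x \<in> B g" "y \<in> B g" "\<rho> y < \<rho> x"
  have *: "len t = 1" "t \<preceq> g" "t \<in> carrier G" if "t \<in> B g" for t
    using that by (auto simp: B_iff)
  have "len g \<noteq> 1"
  proof
    assume "len g = 1"
    then have "x = g" "y = g" using le_len_eq * xy g by auto
    then show False using xy by simp
  qed
  then have "len g = 2" using le_len[of x g] * xy g by force
  then have "g \<in> R g" using g by (simp add: R_iff)
  then show "(\<exists>k\<in>R g. x \<in> B k \<and> y \<in> B k) \<or> (\<exists>z\<in>B g. \<rho> y < \<rho> z \<and> \<rho> z < \<rho> x)"
    using xy by blast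
qed

lemma gens_connectedD:
  assumes "gens_connected g" "S \<subseteq> B g" "S \<noteq> {}" "\<not> B g \<subseteq> S"
  obtains k where "k \<in> R g" "S \<inter> B k \<noteq> {}" "\<not> B k \<subseteq> S"
  using assms unfolding gens_connected_def by meson

text \<open>Connectivity applied to a singleton gives a rank two element whose cycle leaves it, and
  only the other generator is available.\<close>

lemma separated_two_gens:
  assumes g: "g \<in> carrier G" "g \<preceq> c" and ab: "B g \<subseteq> {a, b}"
  shows "separated g"
proof (cases "len g \<le> 2")
  case False
  show ?thesis
    unfolding separated_def
  proof (intro ballI impI)
    fix x y assume xy: "x \<in> B g" "y \<in> B g" "\<rho> y < \<rho> x"
    then have "x \<noteq> y" by auto
    then have Bg: "B g = {x, y}" using ab xy by blast
    have "gens_connected g" using connected_below g False by simp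
    moreover have "\<not> B g \<subseteq> {x}" "{x} \<subseteq> B g" using Bg \<open>x \<noteq> y\<close> by auto
    ultimately obtain k where k: "k \<in> R g" "{x} \<inter> B k \<noteq> {}" "\<not> B k \<subseteq> {x}"
      using gens_connectedD[of g "{x}"] by blast
    have "B k \<subseteq> B g" using B_mono k g by (auto simp: R_iff)
    then show "(\<exists>k\<in>R g. x \<in> B k \<and> y \<in> B k) \<or> (\<exists>z\<in>B g. \<rho> y < \<rho> z \<and> \<rho> z < \<rho> x)"
      using k Bg by blast
  qed
qed (use separated_rank_le_2 g in blast)


section \<open>Commuting generators\<close>

text \<open>Induction on \<open>d\<close>, using \<open>B_closure\<close> from \<open>a\<close>.
  Removing \<open>a\<close> leaves \<open>d\<close>. If \<open>b\<close> lies below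
  \<open>d\<close>, removing \<open>b\<close> leaves \<open>a \<otimes> (inv b \<otimes> d)\<close>
  because \<open>a\<close> and \<open>b\<close> commute, which the induction covers. If not, only
  squares of \<open>a\<close> occur.\<close>

lemma B_commuting:
  assumes ab: "a \<in> A" "b \<in> A" "a \<otimes> b = b \<otimes> a"
  shows "d \<in> carrier G \<Longrightarrow> a \<in> B (a \<otimes> d) \<Longrightarrow> a \<otimes> d \<preceq> c \<Longrightarrow> B d \<subseteq> {a, b} \<Longrightarrow> B (a \<otimes> d) \<subseteq> {a, b}"
proof (induction "len d" arbitrary: d rule: less_induct)
  case less
  let ?g = "a \<otimes> d"
  have car: "a \<in> carrier G" "b \<in> carrier G" "?g \<in> carrier G" using ab less.prems by auto
  have i: "inv a \<otimes> ?g = d" using car less.prems by simp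
  have l: "len ?g = Suc (len d)" using suffix_below(4)[OF less.prems(2) car(3) less.prems(3)] i by simp
  have R: "t \<otimes> u \<in> R c" if "t \<in> B ?g" "u \<in> B (inv t \<otimes> ?g)" for t u
    using pair_in_R[OF that car(3)] R_below[OF less.prems(3) car(3)] by blast
  have pair: "B (t \<otimes> u) \<subseteq> {a, b}" if "t \<otimes> u \<in> R c" "t \<in> {a, b}" "u \<in> {a, b}" for t u
    using that commuting_pair[of t u] ab by auto
  show ?case
  proof (cases "d = \<one>")
    case True
    then show ?thesis using B_gen[OF ab(1)] car by auto
  next
    case False
    then have l2: "2 \<le> len ?g" using l len_eq_0[of d] less.prems by linarith
    show ?thesis
    proof (cases "b \<in> B d")
      case False
      have "B ?g \<subseteq> {a}"
      proof (rule B_closure[OF car(3) less.prems(3) l2 _ less.prems(2)])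
        show "B (t \<otimes> u) \<subseteq> {a}" if "t \<in> {a}" "t \<in> B ?g" "u \<in> B (inv t \<otimes> ?g)" for t u
          using that R[of t u] i square[of a] ab False less.prems(4) by auto
      qed simp
      then show ?thesis by blast
    next
      case b: True
      note suf = suffix_below[OF b less.prems(1)]
      have dc: "d \<preceq> c" using suffix_below(2)[OF less.prems(2) car(3) less.prems(3)] i by simp
      let ?d = "inv b \<otimes> d"
      have e: "inv b \<otimes> ?g = a \<otimes> ?d"
      proof -
        have "b \<otimes> (a \<otimes> ?d) = (b \<otimes> a) \<otimes> ?d" using car less.prems by (simp add: m_assoc)
        also have "\<dots> = ?g" using car less.prems ab(3)[symmetric] by (simp add: m_assoc)
        finally show ?thesis using car less.prems by (metis inv_mult_cancel(1) inv_closed m_closed)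
      qed
      show ?thesis
      proof (rule B_closure[OF car(3) less.prems(3) l2 _ less.prems(2)])
        fix t u assume t: "t \<in> {a, b}" "t \<in> B ?g" and u: "u \<in> B (inv t \<otimes> ?g)"
        have "u \<in> {a, b}"
        proof (cases "t = a")
          case True
          then show ?thesis using u i less.prems(4) by auto
        next
          case False
          then have tb: "t = b" using t by blast
          note suf' = suffix_below[OF t(2) car(3) less.prems(3)]
          have ll: "len (a \<otimes> ?d) = Suc (len ?d)" using suf'(4) suf(4)[OF dc] l unfolding tb e by simp
          then have "a \<in> B (a \<otimes> ?d)" using ab car less.prems by (simp add: B_iff le_mult_iff)
          moreover have "B ?d \<subseteq> {a, b}" using B_mono[OF suf(3)[OF dc] _ less.prems(1)] car less.prems by auto
          ultimately have "B (a \<otimes> ?d) \<subseteq> {a, b}"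
            using less.hyps[of ?d] suf(4)[OF dc] suf'(2) car less.prems unfolding tb e by simp
          then show ?thesis using u unfolding tb e by blast
        qed
        then show "B (t \<otimes> u) \<subseteq> {a, b}" using pair R t u by blast
      qed simp
    qed
  qed
qed

lemma eq_power:
  assumes b: "b \<in> A"
  shows "d \<in> carrier G \<Longrightarrow> d \<preceq> c \<Longrightarrow> B d \<subseteq> {b} \<Longrightarrow> d = b [^] len d"
proof (induction "len d" arbitrary: d)
  case 0
  then show ?case using len_eq_0[of d] by simp
next
  case (Suc n)
  have bB: "b \<in> B d" using B_nonempty[of d] Suc len_eq_0[of d] by auto
  note suf = suffix_below[OF bB Suc.prems(1,2)]
  let ?d = "inv b \<otimes> d"
  have l: "len ?d = n" using suf(4) Suc.hyps by simp
  have bc: "b \<in> carrier G" using b by simp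
  have "?d = b [^] len ?d"
    using Suc.hyps(1)[of ?d] suf l B_mono[OF suf(3,1) Suc.prems(1)] Suc.prems(3) by blast
  then have "d = b \<otimes> b [^] n" using bc Suc.prems unfolding l by (metis inv_mult_cancel(2))
  then show ?case unfolding Suc.hyps(2)[symmetric] nat_pow_Suc2[OF bc] .
qed


section \<open>Long cycles\<close>

definition conj_by :: "'a \<Rightarrow> 'a \<Rightarrow> 'a" where
  "conj_by g x = inv g \<otimes> x \<otimes> g"

lemma conj_by_eq:
  assumes "g \<in> carrier G" "x \<in> carrier G" "y \<in> carrier G" "x \<otimes> g = g \<otimes> y"
  shows "conj_by g x = y"
  using assms unfolding conj_by_def by (simp add: m_assoc)

lemma funpow_conj_by_gen: "g \<in> carrier G \<Longrightarrow> x \<in> A \<Longrightarrow> (conj_by g ^^ j) x \<in> A"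
  by (induction j) (auto simp: conj_by_def conj_gen)

lemma funpow_conj_by_closed: "g \<in> carrier G \<Longrightarrow> x \<in> carrier G \<Longrightarrow> (conj_by g ^^ j) x \<in> carrier G"
  by (induction j) (auto simp: conj_by_def)

lemma funpow_conj_by_mult:
  "g \<in> carrier G \<Longrightarrow> x \<in> carrier G \<Longrightarrow> y \<in> carrier G \<Longrightarrow>
    (conj_by g ^^ j) (x \<otimes> y) = (conj_by g ^^ j) x \<otimes> (conj_by g ^^ j) y"
proof (induction j)
  case (Suc j)
  then show ?case
    using conj_mult[OF Suc.prems(1), of "(conj_by g ^^ j) x" "(conj_by g ^^ j) y"] funpow_conj_by_closed
    by (simp add: conj_by_def[of g "_ \<otimes> _"] conj_by_def[of g "(conj_by g ^^ j) x"]
      conj_by_def[of g "(conj_by g ^^ j) y"])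
qed simp

lemma funpow_conj_by_inj:
  assumes g: "g \<in> carrier G"
  shows "x \<in> carrier G \<Longrightarrow> y \<in> carrier G \<Longrightarrow> (conj_by g ^^ j) x = (conj_by g ^^ j) y \<Longrightarrow> x = y"
proof (induction j)
  case (Suc j)
  let ?x = "(conj_by g ^^ j) x" and ?y = "(conj_by g ^^ j) y"
  have c: "?x \<in> carrier G" "?y \<in> carrier G" using funpow_conj_by_closed Suc.prems g by simp_all
  have "conj_by g ?x = conj_by g ?y" using Suc.prems by simp
  then have "g \<otimes> (inv g \<otimes> ?x \<otimes> g) \<otimes> inv g = g \<otimes> (inv g \<otimes> ?y \<otimes> g) \<otimes> inv g"
    unfolding conj_by_def by (rule arg_cong)
  then have "?x = ?y" unfolding conj_conj_inv[OF g c(1)] conj_conj_inv[OF g c(2)] .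
  then show ?case using Suc.IH Suc.prems(1,2) by blast
qed simp

lemma funpow_conj_by_R:
  assumes g: "g \<in> carrier G"
  shows "k \<in> R g \<Longrightarrow> (conj_by g ^^ j) k \<in> R g"
proof (induction j)
  case (Suc j)
  then have "(conj_by g ^^ j) k \<in> R g" by simp
  then show ?case
    using conj_self_le[of "(conj_by g ^^ j) k" g] g by (simp add: R_iff conj_by_def[of g "(conj_by g ^^ j) k"])
qed simp

lemma rank_bound: obtains N where "\<And>t. t \<in> B c \<Longrightarrow> \<rho> t < N"
proof
  show "\<rho> t < Suc (Max (\<rho> ` B c))" if "t \<in> B c" for t
    using that finite_B by (simp add: less_Suc_eq_le)
qed

text \<open>Conjugation by \<open>g\<close> maps the arc from \<open>v\<close> down to \<open>u\<close> to the arc from \<open>b\<close> down to \<open>x\<close>, which is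
  strictly contained in it. Iterating the conjugation yields an infinite strictly decreasing sequence
  of arcs.\<close>

lemma long_cycle_False:
  assumes A: "a \<in> A" "b \<in> A" "x \<in> A" "v \<in> A"
    and g: "g = a \<otimes> (b \<otimes> b)" "g \<preceq> c" and R: "a \<otimes> b \<in> R g"
    and eq: "b \<otimes> x = a \<otimes> b" "v \<otimes> a = a \<otimes> b" and ne: "a \<otimes> b \<noteq> b \<otimes> a" "x \<noteq> v"
  shows False
proof -
  have car: "a \<in> carrier G" "b \<in> carrier G" "x \<in> carrier G" "v \<in> carrier G" "g \<in> carrier G"
    using A g by auto
  \<comment> \<open>The predecessor of \<open>v\<close>, so that \<open>u\<close>, \<open>v\<close>,
    \<open>a\<close>, \<open>b\<close>, \<open>x\<close> are consecutive in the cycle of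
    \<open>a \<otimes> b\<close>.\<close>
  define u where "u = v \<otimes> a \<otimes> inv v"
  have uA: "u \<in> A" unfolding u_def using conj_gen' A by simp
  then have uc: "u \<in> carrier G" by simp
  have uv: "u \<otimes> v = a \<otimes> b" unfolding u_def using car eq by (simp add: m_assoc)
  have d1: "b \<noteq> x" using eq(1) ne(1) car right_cancel[of b b a] by auto
  have d2: "v \<noteq> b" using eq(2) ne(1) by auto
  have d3: "u \<noteq> v"
  proof
    assume "u = v"
    then have "v \<otimes> v = v \<otimes> a" using uv eq by simp
    then have "v = a" using car by simp
    then show False using eq(2) ne(1) car by simp
  qed
  let ?F = "conj_by g"
  have Fv: "?F v = b"
  proof (rule conj_by_eq)
    have "v \<otimes> g = (v \<otimes> a) \<otimes> (b \<otimes> b)" unfolding g using car by (simp add: m_assoc)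
    also have "\<dots> = g \<otimes> b" unfolding eq g using car by (simp add: m_assoc)
    finally show "v \<otimes> g = g \<otimes> b" .
  qed (use car in auto)
  have Fu: "?F u = x"
  proof (rule conj_by_eq)
    have "u \<otimes> g = u \<otimes> (a \<otimes> b) \<otimes> b" unfolding g using car uc by (simp add: m_assoc)
    also have "\<dots> = u \<otimes> (v \<otimes> a) \<otimes> b" unfolding eq(2) ..
    also have "\<dots> = (u \<otimes> v) \<otimes> (a \<otimes> b)" using car uc by (simp add: m_assoc)
    also have "\<dots> = (a \<otimes> b) \<otimes> (b \<otimes> x)" unfolding uv eq by simp
    finally show "u \<otimes> g = g \<otimes> x" unfolding g using car by (simp add: m_assoc)
  qed (use car uc in auto)
  obtain N where N: "\<And>t. t \<in> B c \<Longrightarrow> \<rho> t < N" using rank_bound by blast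
  define f where "f j = arc N (\<rho> ((?F ^^ j) b)) (\<rho> ((?F ^^ j) x))" for j
  have "f (Suc j) < f j" for j
  proof -
    let ?P = "?F ^^ Suc j"
    \<comment> \<open>Conjugation by \<open>g\<close> fixes \<open>g\<close>, so all iterated
      conjugates of \<open>a \<otimes> b\<close> stay below \<open>g\<close> and
      \<open>cyclic_gap\<close> applies to each of their cycles.\<close>
    have k: "?P (a \<otimes> b) \<in> R c" using funpow_conj_by_R[OF car(5) R] R_below[OF g(2) car(5)] by blast
    note k' = R_c[OF k]
    have PA: "?P b \<in> A" "?P x \<in> A" "?P u \<in> A" "?P v \<in> A"
      using funpow_conj_by_gen[OF car(5)] A uA by blast+
    have bx: "?P b \<otimes> ?P x = ?P (a \<otimes> b)" using funpow_conj_by_mult[OF car(5,2,3), of "Suc j"] eq by simp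
    have uv': "?P u \<otimes> ?P v = ?P (a \<otimes> b)" using funpow_conj_by_mult[OF car(5) uc car(4), of "Suc j"] uv by simp
    note BX = B_rank2_mult[OF k'(1,2) PA(1,2) bx]
    note UV = B_rank2_mult[OF k'(1,2) PA(3,4) uv']
    have ne': "?P b \<noteq> ?P x" "?P v \<noteq> ?P b" "?P v \<noteq> ?P x" "?P u \<noteq> ?P v"
      using funpow_conj_by_inj[OF car(5)] car uc d1 d2 d3 ne(2) by metis+
    have mem: "?P b \<in> B c" "?P x \<in> B c" "?P u \<in> B c" "?P v \<in> B c"
      using BX UV k'(5) by blast+
    have "arc N (\<rho> (?P b)) (\<rho> (?P x)) < arc N (\<rho> (?P v)) (\<rho> (?P u))"
    proof (rule arc_less_arc)
      show "\<not> cyc (\<rho> (?P b)) (\<rho> (?P v)) (\<rho> (?P x))" using cyclic_gap[OF k BX(1) UV(2)] BX(3) by simp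
      show "\<not> cyc (\<rho> (?P u)) (\<rho> (?P x)) (\<rho> (?P v))" using cyclic_gap[OF k UV(1) BX(2)] UV(3) by simp
      show "\<rho> (?P b) \<noteq> \<rho> (?P x)" "\<rho> (?P v) \<noteq> \<rho> (?P b)" "\<rho> (?P v) \<noteq> \<rho> (?P x)" "\<rho> (?P u) \<noteq> \<rho> (?P v)"
        using rank_eq mem ne' by metis+
    qed (use N mem in blast)+
    moreover have "?P v = (?F ^^ j) b" "?P u = (?F ^^ j) x"
      using Fv Fu by (simp_all add: funpow_swap1)
    ultimately show ?thesis unfolding f_def by simp
  qed
  then show False by (rule no_infinite_descent)
qed


section \<open>Braided triples\<close>

lemma mult_ext:
  assumes "x \<otimes> y = z \<otimes> w" "x \<in> carrier G" "y \<in> carrier G" "z \<in> carrier G" "w \<in> carrier G" "t \<in> carrier G"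
  shows "x \<otimes> (y \<otimes> t) = z \<otimes> (w \<otimes> t)"
  using assms by (metis m_assoc)

text \<open>A cycle of length three, as in the dual presentation of the braid group on three
  strands: \<open>p\<close> and \<open>q\<close> satisfy the braid relation, and \<open>r\<close> is
  \<open>inv q \<otimes> p \<otimes> q\<close>.\<close>

definition triad :: "'a \<Rightarrow> 'a \<Rightarrow> 'a \<Rightarrow> bool" where
  "triad p q r \<longleftrightarrow> p \<in> A \<and> q \<in> A \<and> r \<in> A \<and> q \<otimes> r = p \<otimes> q \<and> r \<otimes> p = p \<otimes> q \<and> p \<noteq> q"

text \<open>The equations with a trailing factor \<open>t\<close> are rewrite rules for right-nested
  products: they eliminate adjacent pairs containing \<open>r\<close> and normalize the braid
  relation.\<close>

lemma triadD:
  assumes "triad p q r"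
  shows "p \<in> A" "q \<in> A" "r \<in> A" "p \<in> carrier G" "q \<in> carrier G" "r \<in> carrier G"
    "q \<otimes> r = p \<otimes> q" "r \<otimes> p = p \<otimes> q" "p \<noteq> q" "q \<noteq> r" "p \<noteq> r"
    "t \<in> carrier G \<Longrightarrow> q \<otimes> (r \<otimes> t) = p \<otimes> (q \<otimes> t)"
    "t \<in> carrier G \<Longrightarrow> r \<otimes> (p \<otimes> t) = p \<otimes> (q \<otimes> t)"
    "q \<otimes> (p \<otimes> q) = p \<otimes> (q \<otimes> p)"
    "t \<in> carrier G \<Longrightarrow> q \<otimes> (p \<otimes> (q \<otimes> t)) = p \<otimes> (q \<otimes> (p \<otimes> t))"
proof -
  show A: "p \<in> A" "q \<in> A" "r \<in> A" and eq: "q \<otimes> r = p \<otimes> q" "r \<otimes> p = p \<otimes> q" and ne: "p \<noteq> q"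
    using assms by (auto simp: triad_def)
  show car: "p \<in> carrier G" "q \<in> carrier G" "r \<in> carrier G" using A by auto
  show "q \<noteq> r" using eq(1) ne car right_cancel[of q q p] by auto
  show "p \<noteq> r" using eq(2) ne car Units_l_cancel[of p p q] by auto
  show e1: "q \<otimes> (r \<otimes> t) = p \<otimes> (q \<otimes> t)" and e2: "r \<otimes> (p \<otimes> t) = p \<otimes> (q \<otimes> t)" if "t \<in> carrier G" for t
    using mult_ext eq car that by metis+
  show e3: "q \<otimes> (p \<otimes> q) = p \<otimes> (q \<otimes> p)"
    unfolding eq(2)[symmetric] using e1[OF car(1)] .
  show "q \<otimes> (p \<otimes> (q \<otimes> t)) = p \<otimes> (q \<otimes> (p \<otimes> t))" if "t \<in> carrier G" for t
    using e3 car that by (metis m_assoc m_closed)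
qed

lemma triad_rotate: "triad p q r \<Longrightarrow> triad q r p"
  unfolding triad_def[of q r p] by (simp add: triadD(1-3,7,8,10))

text \<open>Put \<open>d = p \<otimes> q\<close>. Conjugation by \<open>d\<close> permutes the triad
  cyclically, so conjugation by \<open>g = d \<otimes> (d \<otimes> p)\<close> fixes
  \<open>q\<close> and sends \<open>r\<close> to \<open>p\<close>. In every conjugated triangle the
  arc from the image of \<open>p\<close> down to \<open>q\<close> is shorter than that from the
  image of \<open>r\<close>, and this descent never ends.\<close>

lemma triad_braid5_False:
  assumes tr: "triad p q r" and g: "g = p \<otimes> (q \<otimes> (p \<otimes> (q \<otimes> p)))" "g \<preceq> c" and R: "p \<otimes> q \<in> R g"
  shows False
proof -
  note t = triadD[OF tr]
  define d where "d = p \<otimes> q"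
  have d: "d \<in> carrier G" "p \<otimes> q = d" "r \<otimes> p = d" using t by (simp_all add: d_def)
  have gd: "g = d \<otimes> (d \<otimes> p)" unfolding g d_def using t by (simp add: m_assoc)
  have gc: "g \<in> carrier G" using gd d t by simp
  have "p \<otimes> d = d \<otimes> r" "q \<otimes> d = d \<otimes> p" "r \<otimes> d = d \<otimes> q"
    unfolding d_def using t by (simp_all add: m_assoc)
  then have ext: "p \<otimes> (d \<otimes> x) = d \<otimes> (r \<otimes> x)" "q \<otimes> (d \<otimes> x) = d \<otimes> (p \<otimes> x)" "r \<otimes> (d \<otimes> x) = d \<otimes> (q \<otimes> x)"
    if "x \<in> carrier G" for x
    using mult_ext d t that by metis+
  let ?F = "conj_by g"
  have Fq: "?F q = q"
    by (rule conj_by_eq[OF gc]) (use t(4-6) d in \<open>simp_all add: gd m_assoc ext\<close>)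
  have Fr: "?F r = p"
    by (rule conj_by_eq[OF gc]) (use t(4-6) d in \<open>simp_all add: gd m_assoc ext\<close>)
  have Fqj: "(?F ^^ j) q = q" for j by (induction j) (use Fq in auto)
  obtain N where N: "\<And>t. t \<in> B c \<Longrightarrow> \<rho> t < N" using rank_bound by blast
  define f where "f j = arc N (\<rho> ((?F ^^ j) r)) (\<rho> q)" for j
  have "f (Suc j) < f j" for j
  proof -
    let ?P = "?F ^^ j"
    have k: "?P (p \<otimes> q) \<in> R c" using funpow_conj_by_R[OF gc R] R_below[OF g(2) gc] by blast
    have PA: "?P p \<in> A" "?P q \<in> A" "?P r \<in> A" using funpow_conj_by_gen[OF gc] t by blast+
    \<comment> \<open>The conjugated triangle is read starting from its fixed corner
      \<open>q\<close>.\<close>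
    have e: "?P (p \<otimes> q) = q \<otimes> ?P r" "?P r \<otimes> ?P p = q \<otimes> ?P r" "?P p \<otimes> q = q \<otimes> ?P r"
      using funpow_conj_by_mult[OF gc, of _ _ j] t Fqj[of j] by metis+
    have ne: "q \<noteq> ?P r" using funpow_conj_by_inj[OF gc, of q r j] t Fqj by auto
    have k1: "q \<otimes> ?P r \<in> R c" using k e by simp
    note T = triangle[OF k1 t(2) PA(3,1) e(2,3) ne]
    have "{q, ?P r, ?P p} \<subseteq> B c" using T(1) R_c(5)[OF k1] by simp
    then have "arc N (\<rho> (?P p)) (\<rho> q) < arc N (\<rho> (?P r)) (\<rho> q)"
      using cyc_arc_less[OF T(2)] N by simp
    moreover have "?P p = (?F ^^ Suc j) r" using Fr by (simp add: funpow_swap1)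
    ultimately show ?thesis unfolding f_def by simp
  qed
  then show False by (rule no_infinite_descent)
qed

section \<open>Braid words of length three and four\<close>

lemma reduced_triple:
  assumes "x \<in> A" "y \<in> A" "z \<in> A" "g = x \<otimes> (y \<otimes> z)" "len g = 3"
  shows "x \<in> B g" "inv x \<otimes> g = y \<otimes> z" "x \<otimes> y \<in> R g" "y \<otimes> z \<in> R g"
proof -
  have car: "x \<in> carrier G" "y \<in> carrier G" "z \<in> carrier G" using assms by auto
  have l: "len (x \<otimes> (y \<otimes> z)) = len x + len y + len z"
    using assms(5) len_gen[OF assms(1)] len_gen[OF assms(2)] len_gen[OF assms(3)] unfolding assms(4) by linarith
  note m = le_mult3[OF car l]
  show "x \<in> B g" "inv x \<otimes> g = y \<otimes> z" unfolding assms(4) using m assms car by (simp_all add: B_iff)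
  show "x \<otimes> y \<in> R g" "y \<otimes> z \<in> R g" 
    unfolding assms(4) R_iff using m assms car suffix_le[of x "y \<otimes> z"] by simp_all
qed

text \<open>When \<open>y\<close> has smaller rank than \<open>x\<close>, lying cyclically between
  them means lying between them in rank. Separation can thus be checked on the circle, for pairs in
  both orders.\<close>

lemma separatedI:
  assumes "g \<in> carrier G" "g \<preceq> c"
    and "\<And>x y. x \<in> B g \<Longrightarrow> y \<in> B g \<Longrightarrow> x \<noteq> y \<Longrightarrow>
      (\<exists>k\<in>R g. {x, y} \<subseteq> B k) \<or> (\<exists>z\<in>B g. cyc (\<rho> x) (\<rho> z) (\<rho> y))"
  shows "separated g"
  unfolding separated_def
proof (intro ballI impI)
  fix x y assume "x \<in> B g" "y \<in> B g" "\<rho> y < \<rho> x"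
  then show "(\<exists>k\<in>R g. x \<in> B k \<and> y \<in> B k) \<or> (\<exists>z\<in>B g. \<rho> y < \<rho> z \<and> \<rho> z < \<rho> x)"
    using assms(3)[of x y] unfolding cyc_def by fastforce
qed

text \<open>For a triad \<open>p\<close>, \<open>q\<close>, \<open>r\<close> this is the third
  corner of a second triangle, the cycle of \<open>p \<otimes> r\<close>, glued to the first along
  the edge from \<open>p\<close> to \<open>r\<close>.\<close>

definition ear :: "'a \<Rightarrow> 'a \<Rightarrow> 'a" where
  "ear p r = p \<otimes> r \<otimes> inv p"

lemma triad_ear:
  assumes "triad p q r"
  shows "ear p r \<in> A" "ear p r \<otimes> p = p \<otimes> r" "r \<otimes> ear p r = p \<otimes> r" "ear p r \<noteq> p"
proof -
  note t = triadD[OF assms]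
  show A: "ear p r \<in> A" unfolding ear_def using conj_gen' t by blast
  show e: "ear p r \<otimes> p = p \<otimes> r" unfolding ear_def using t by (simp add: m_assoc)
  have "(r \<otimes> ear p r) \<otimes> p = (p \<otimes> r) \<otimes> p" using t A e by (simp add: m_assoc)
  then show "r \<otimes> ear p r = p \<otimes> r" using A t(4,6) by (metis gen_closed m_closed right_cancel)
  show "ear p r \<noteq> p" using e t by auto
qed

lemma triad_ear_triangle:
  assumes tr: "triad p q r" and R: "p \<otimes> r \<in> R c"
  shows "B (p \<otimes> r) = {ear p r, p, r}" "cyc (\<rho> (ear p r)) (\<rho> p) (\<rho> r)"
proof -
  note t = triadD[OF tr] and e = triad_ear[OF tr]
  have "ear p r \<otimes> p \<in> R c" using R e by simp
  from triangle[OF this e(1) t(1,3) _ _ e(4)] e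
  show "B (p \<otimes> r) = {ear p r, p, r}" "cyc (\<rho> (ear p r)) (\<rho> p) (\<rho> r)" by auto
qed

lemma triad_triangle:
  assumes tr: "triad p q r" and R: "p \<otimes> q \<in> R c"
  shows "B (p \<otimes> q) = {p, q, r}" "cyc (\<rho> p) (\<rho> q) (\<rho> r)"
  using triangle[OF R] triadD[OF tr] by auto

text \<open>The reduced words \<open>p r p\<close>, \<open>q r r\<close>, \<open>r p r\<close> and
  \<open>ear p p\<close> start with the four generators and leave suffixes of length two with known
  cycles. The circular order is \<open>ear p r\<close>, \<open>p\<close>, \<open>q\<close>,
  \<open>r\<close>. The one pair left without a shared triangle is \<open>q\<close> and the ear,
  which \<open>p\<close> and \<open>r\<close> separate on either side.\<close>

lemma braid3:
  assumes tr: "triad p q r" and g: "g = p \<otimes> (r \<otimes> p)" "g \<preceq> c" "len g = 3"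
  shows "B g = {p, q, r, ear p r}" "p \<otimes> q \<in> R g" "p \<otimes> r \<in> R g" "separated g"
proof -
  note t = triadD[OF tr] and e = triad_ear[OF tr]
  let ?a = "ear p r"
  have gc: "g \<in> carrier G" using g t by simp
  have ac: "?a \<in> carrier G" using e by simp
  have gr: "g = r \<otimes> (p \<otimes> r)" and gq: "g = q \<otimes> (r \<otimes> r)" unfolding g using t by simp_all
  have ga: "g = ?a \<otimes> (p \<otimes> p)"
  proof -
    have "?a \<otimes> (p \<otimes> p) = (?a \<otimes> p) \<otimes> p" using ac t by (simp add: m_assoc)
    then show ?thesis unfolding e g using t by (simp add: m_assoc)
  qed
  note P = reduced_triple[OF t(1) t(3) t(1) g(1,3)]
    and Q = reduced_triple[OF t(2) t(3) t(3) gq g(3)]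
    and Rr = reduced_triple[OF t(3) t(1) t(3) gr g(3)]
    and E = reduced_triple[OF e(1) t(1) t(1) ga g(3)]
  show R: "p \<otimes> q \<in> R g" "p \<otimes> r \<in> R g" using P t by auto
  have Rc: "p \<otimes> q \<in> R c" "p \<otimes> r \<in> R c" "p \<otimes> p \<in> R c" "r \<otimes> r \<in> R c"
    using R E Q R_below[OF g(2) gc] by auto
  note T1 = triad_triangle[OF tr Rc(1)] and T2 = triad_ear_triangle[OF tr Rc(2)]
  have sq: "B (p \<otimes> p) = {p}" "B (r \<otimes> r) = {r}" using square Rc t by auto
  have "B g \<subseteq> {p, q, r, ?a}"
  proof (rule B_closure[OF gc g(2) _ _ P(1)])
    fix s u assume s: "s \<in> {p, q, r, ?a}" "s \<in> B g" and u: "u \<in> B (inv s \<otimes> g)"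
    consider "s = p" | "s = q" | "s = r" | "s = ?a" using s by blast
    then show "B (s \<otimes> u) \<subseteq> {p, q, r, ?a}"
    proof cases
      case 1
      then have "u \<in> {p, q, r}" using u unfolding 1 P(2) using t T1 by simp
      then show ?thesis using 1 T1 T2 sq by auto
    next
      case 2
      then have "u = r" using u unfolding 2 Q(2) sq by simp
      then show ?thesis using 2 T1 t by auto
    next
      case 3
      then have "u \<in> {?a, p, r}" using u unfolding 3 Rr(2) T2 by simp
      then show ?thesis using 3 T1 T2 sq t e by auto
    next
      case 4
      then have "u = p" using u unfolding 4 E(2) sq by simp
      then show ?thesis using 4 T2 e by auto
    qed
  qed (use g in simp_all)
  then show B: "B g = {p, q, r, ?a}" using P Q Rr E by blast
  show "separated g"
  proof (rule separatedI[OF gc g(2)])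
    fix x y assume xy: "x \<in> B g" "y \<in> B g" "x \<noteq> y"
    have sh1: "\<exists>k\<in>R g. {x, y} \<subseteq> B k" if "{x, y} \<subseteq> {p, q, r}"
      using that R T1 by (intro bexI[of _ "p \<otimes> q"]) auto
    have sh2: "\<exists>k\<in>R g. {x, y} \<subseteq> B k" if "{x, y} \<subseteq> {?a, p, r}"
      using that R T2 by (intro bexI[of _ "p \<otimes> r"]) auto
    note c1 = cyc_outside[OF T1(2) T2(2)]
    have "{x, y} \<subseteq> {p, q, r} \<or> {x, y} \<subseteq> {?a, p, r} \<or> x = q \<and> y = ?a \<or> x = ?a \<and> y = q"
      using xy B by auto
    then show "(\<exists>k\<in>R g. {x, y} \<subseteq> B k) \<or> (\<exists>z\<in>B g. cyc (\<rho> x) (\<rho> z) (\<rho> y))"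
      using sh1 sh2 c1 B by blast
  qed
qed

text \<open>The square of \<open>p \<otimes> q\<close> does not change when the triad is rotated, so
  it suffices to remove \<open>p\<close> or its ear. The suffixes are \<open>q p q\<close>, treated
  by \<open>braid3\<close>, and the cube of \<open>p\<close>, treated by
  \<open>B_power\<close>.\<close>

lemma braid4_half:
  assumes tr: "triad p q r" and g: "g = p \<otimes> (q \<otimes> (p \<otimes> q))" "g \<preceq> c" "len g = 4"
  shows "p \<in> B g" "ear p r \<in> B g" "p \<otimes> q \<in> R g" "p \<otimes> r \<in> R g"
    "B (p \<otimes> q) = {p, q, r}" "B (p \<otimes> r) = {ear p r, p, r}"
    "cyc (\<rho> p) (\<rho> q) (\<rho> r)" "cyc (\<rho> (ear p r)) (\<rho> p) (\<rho> r)"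
    "s \<in> {p, ear p r} \<Longrightarrow> u \<in> B (inv s \<otimes> g) \<Longrightarrow> B (s \<otimes> u) \<subseteq> {p, q, r, ear p r, ear q p}"
    "s \<in> {p, ear p r} \<Longrightarrow> separated (inv s \<otimes> g)"
proof -
  note t = triadD[OF tr] and e = triad_ear[OF tr]
  let ?a = "ear p r"
  have tr': "triad q r p" using triad_rotate[OF tr] .
  note e' = triad_ear[OF tr']
  have gc: "g \<in> carrier G" using g t by simp
  have ac: "?a \<in> carrier G" using e by simp
  have cube: "p [^] (3::nat) = p \<otimes> (p \<otimes> p)" using t by (simp add: numeral_3_eq_3 m_assoc)
  have ga: "g = ?a \<otimes> p [^] (3::nat)"
  proof -
    have "?a \<otimes> p [^] (3::nat) = (?a \<otimes> p) \<otimes> (p \<otimes> p)" unfolding cube using ac t by (simp add: m_assoc)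
    then show ?thesis unfolding e g using t by (simp add: m_assoc)
  qed
  have l: "len g = Suc (len y)" if "s \<in> A" "y \<in> carrier G" "g = s \<otimes> y" "len y \<le> 3" for s y
    using len_mult_le[of s y] that g(3) by simp
  have B: "s \<in> B g" if "s \<in> A" "y \<in> carrier G" "g = s \<otimes> y" "len y \<le> 3" for s y
    using that l[OF that] le_mult_iff[of s y] by (simp add: B_iff)
  let ?h = "q \<otimes> (p \<otimes> q)"
  have hA: "set [q, p, q] \<subseteq> A" using t by simp
  have lh: "len ?h \<le> 3" using len_word_prod_le[OF hA] t by simp
  have hc: "?h \<in> carrier G" using t by simp
  show p: "p \<in> B g" using B[OF t(1) hc g(1) lh] .
  have lh3: "len ?h = 3" using l[OF t(1) hc g(1) lh] g(3) by simp
  have pc: "p [^] (3::nat) \<in> carrier G" using t by simp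
  note lp = len_power_le[OF t(1), of 3]
  show a: "?a \<in> B g" using B[OF e(1) pc ga lp] .
  have lp3: "len (p [^] (3::nat)) = 3" using l[OF e(1) pc ga lp] g(3) by simp
  have ip: "inv p \<otimes> g = ?h" unfolding g using t by simp
  have ia: "inv ?a \<otimes> g = p [^] (3::nat)" unfolding ga using ac pc by simp
  have hle: "?h \<preceq> g" "?h \<preceq> c" using suffix_below[OF p gc g(2)] ip by simp_all
  have ple: "p [^] (3::nat) \<preceq> c" using suffix_below[OF a gc g(2)] ia by simp
  \<comment> \<open>In the rotated triad \<open>q\<close>, \<open>r\<close>, \<open>p\<close>, the
    suffix \<open>q p q\<close> has the shape required by \<open>braid3\<close>.\<close>
  note h3 = braid3[OF tr' refl hle(2) lh3]
  have R: "u \<in> B (inv s \<otimes> g) \<Longrightarrow> s \<in> B g \<Longrightarrow> s \<otimes> u \<in> R g" for s u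
    using pair_in_R gc by blast
  have uB: "u \<in> B (inv p \<otimes> g) \<longleftrightarrow> u \<in> {q, r, p, ear q p}" for u unfolding ip h3(1) ..
  show Rg: "p \<otimes> q \<in> R g" "p \<otimes> r \<in> R g" using R p uB by blast+
  have sub: "R g \<subseteq> R c" using R_below g gc by blast
  show T: "B (p \<otimes> q) = {p, q, r}" "cyc (\<rho> p) (\<rho> q) (\<rho> r)"
    and E: "B (p \<otimes> r) = {?a, p, r}" "cyc (\<rho> ?a) (\<rho> p) (\<rho> r)"
    using triad_triangle[OF tr] triad_ear_triangle[OF tr] Rg sub by blast+
  have "p \<otimes> p \<in> R c" using R p uB sub by blast
  then have sq: "B (p \<otimes> p) = {p}" using square t by blast
  have "q \<otimes> p \<in> R c" using h3(3) R_below[OF hle(2) hc] by blast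
  then have E': "B (q \<otimes> p) = {ear q p, q, p}" using triad_ear_triangle[OF tr'] by blast
  have Ba: "B (inv ?a \<otimes> g) = {p}" unfolding ia using B_power[OF t(1) ple lp3] by simp
  show "B (s \<otimes> u) \<subseteq> {p, q, r, ?a, ear q p}"
    if s: "s \<in> {p, ?a}" and u: "u \<in> B (inv s \<otimes> g)"
  proof (cases "s = p")
    case True
    then have "u \<in> {q, r, p, ear q p}" using u uB by simp
    moreover have "B (p \<otimes> ear q p) = {ear q p, q, p}" using e'(3) E' by simp
    ultimately show ?thesis using True T E sq by auto
  next
    case False
    then have "s = ?a" using s by blast
    moreover have "u = p" using u calculation Ba by simp
    ultimately show ?thesis using e(2) E by auto
  qed
  show "separated (inv s \<otimes> g)" if "s \<in> {p, ?a}"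
  proof (cases "s = p")
    case True
    then show ?thesis using h3(4) ip by simp
  next
    case False
    then have "s = ?a" using that by blast
    then show ?thesis using separated_two_gens[OF pc ple, of p p] ia B_power[OF t(1) ple lp3] by simp
  qed
qed

text \<open>Each edge of the triangle carries an ear, and the circular order is \<open>p\<close>,
  \<open>ear q p\<close>, \<open>q\<close>, \<open>ear r q\<close>, \<open>r\<close>,
  \<open>ear p r\<close>. Pairs not sharing a triangle have a corner of the central triangle on both
  sides between them.\<close>

lemma braid4:
  assumes tr: "triad p q r" and g: "g = p \<otimes> (q \<otimes> (p \<otimes> q))" "g \<preceq> c" "len g = 4"
  shows "separated g" "s \<in> B g \<Longrightarrow> separated (inv s \<otimes> g)"
proof -
  note t = triadD[OF tr]
  have tr2: "triad q r p" using triad_rotate[OF tr] .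
  have tr3: "triad r p q" using triad_rotate[OF tr2] .
  have g2: "g = q \<otimes> (r \<otimes> (q \<otimes> r))" and g3: "g = r \<otimes> (p \<otimes> (r \<otimes> p))"
    unfolding g using t by simp_all
  have gc: "g \<in> carrier G" using g t by simp
  note H1 = braid4_half[OF tr g] and H2 = braid4_half[OF tr2 g2 g(2,3)] and H3 = braid4_half[OF tr3 g3 g(2,3)]
  let ?a = "ear p r" and ?f = "ear q p" and ?e = "ear r q"
  let ?S = "{p, q, r, ?a, ?f, ?e}"
  have sub: "B g \<subseteq> ?S"
  proof (rule B_closure[OF gc g(2) _ _ H1(1)])
    show "B (s \<otimes> u) \<subseteq> ?S" if "s \<in> ?S" "u \<in> B (inv s \<otimes> g)" for s u
    proof -
      from that(1) consider "s \<in> {p, ?a}" | "s \<in> {q, ?f}" | "s \<in> {r, ?e}" by blast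
      then show ?thesis
        using H1(9)[OF _ that(2)] H2(9)[OF _ that(2)] H3(9)[OF _ that(2)] by cases blast+
    qed
  qed (use g in simp_all)
  then have B: "B g = ?S" using H1(1,2) H2(1,2) H3(1,2) by blast
  show "separated (inv s \<otimes> g)" if "s \<in> B g"
  proof -
    from that sub consider "s \<in> {p, ?a}" | "s \<in> {q, ?f}" | "s \<in> {r, ?e}" by blast
    then show ?thesis using H1(10) H2(10) H3(10) by cases blast+
  qed
  \<comment> \<open>\<open>far\<close> concerns an ear and its opposite corner, \<open>far'\<close>
    two ears.\<close>
  note far = cyc_outside[OF H1(7,8)] cyc_outside[OF H2(7,8)] cyc_outside[OF H3(7,8)]
  note far' = cyc_join[OF far(1) H2(8)] cyc_join[OF far(3) H3(8)] cyc_join[OF far(5) H1(8)]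
  show "separated g"
  proof (rule separatedI[OF gc g(2)])
    fix x y assume xy: "x \<in> B g" "y \<in> B g" "x \<noteq> y"
    have sh: "\<exists>k\<in>R g. {x, y} \<subseteq> B k"
      if "{x, y} \<subseteq> {p, q, r} \<or> {x, y} \<subseteq> {?a, p, r} \<or> {x, y} \<subseteq> {?f, q, p} \<or> {x, y} \<subseteq> {?e, r, q}"
      using that H1(3-6) H2(4,6) H3(4,6) by metis
    have "{x, y} \<subseteq> {p, q, r} \<or> {x, y} \<subseteq> {?a, p, r} \<or> {x, y} \<subseteq> {?f, q, p} \<or> {x, y} \<subseteq> {?e, r, q}
      \<or> {x, y} \<subseteq> {?a, q} \<or> {x, y} \<subseteq> {?f, r} \<or> {x, y} \<subseteq> {?e, p}
      \<or> {x, y} \<subseteq> {?a, ?f} \<or> {x, y} \<subseteq> {?f, ?e} \<or> {x, y} \<subseteq> {?e, ?a}"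
      using xy unfolding B by auto
    moreover have "\<exists>z\<in>B g. cyc (\<rho> x) (\<rho> z) (\<rho> y)"
      if "{x, y} \<subseteq> {?a, q} \<or> {x, y} \<subseteq> {?f, r} \<or> {x, y} \<subseteq> {?e, p}
        \<or> {x, y} \<subseteq> {?a, ?f} \<or> {x, y} \<subseteq> {?f, ?e} \<or> {x, y} \<subseteq> {?e, ?a}"
      using that xy(3) far far' unfolding B by auto
    ultimately show "(\<exists>k\<in>R g. {x, y} \<subseteq> B k) \<or> (\<exists>z\<in>B g. cyc (\<rho> x) (\<rho> z) (\<rho> y))"
      using sh by blast
  qed
qed


section \<open>Elements with a single further cover\<close>

lemma power_prefix:
  assumes A: "a \<in> A" "b \<in> A" and c: "c = a \<otimes> b [^] n" "len c = Suc n" and m: "m \<le> (n::nat)"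
  shows "a \<otimes> b [^] m \<preceq> c" "len (a \<otimes> b [^] m) = Suc m"
proof -
  have car: "a \<in> carrier G" "b \<in> carrier G" using A by auto
  let ?x = "a \<otimes> b [^] m" and ?y = "b [^] (n - m)"
  have e: "c = ?x \<otimes> ?y" unfolding c using car m by (simp add: m_assoc nat_pow_mult)
  have "len ?x \<le> 1 + len (b [^] m)" using len_mult_le[of a "b [^] m"] car A by simp
  then have 1: "len ?x \<le> Suc m" using len_power_le[OF A(2), of m] by simp
  have 2: "len ?y \<le> n - m" using len_power_le[OF A(2)] .
  have 3: "len c \<le> len ?x + len ?y" unfolding e using len_mult_le car by simp
  show 4: "len ?x = Suc m" using 1 2 3 c(2) m by linarith
  have "len (?x \<otimes> ?y) = len ?x + len ?y" using 1 2 3 c(2) m unfolding e[symmetric] by linarith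
  then show "?x \<preceq> c" unfolding e using le_mult_iff car by simp
qed

text \<open>\<open>covers_gen\<close> turns the assumption on the covers of \<open>a\<close> into
  the hypotheses on \<open>b\<close>.\<close>

lemma all_separated:
  assumes a: "a \<in> B c" and b: "b \<in> B (inv a \<otimes> c)" "b \<noteq> a" "B (inv a \<otimes> c) \<subseteq> {a, b}"
    and n: "3 \<le> len c" and g: "g \<in> carrier G" "g \<preceq> c"
  shows "separated g"
proof -
  define d where "d = inv a \<otimes> c"
  have A: "a \<in> A" "b \<in> A" using a b by (auto simp: B_iff)
  then have car: "a \<in> carrier G" "b \<in> carrier G" by auto
  have cd: "c = a \<otimes> d" unfolding d_def using car by simp
  have d: "d \<in> carrier G" "d \<preceq> c" "len c = Suc (len d)"
    using suffix_below[OF a] unfolding d_def by simp_all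
  have bd: "b \<in> B d" "B d \<subseteq> {a, b}" using b unfolding d_def by auto
  have abR: "a \<otimes> b \<in> R c" using pair_in_R[OF a b(1)] by simp
  show ?thesis
  proof (cases "a \<otimes> b = b \<otimes> a")
    case True
    have "B c \<subseteq> {a, b}" using B_commuting[OF A True d(1)] a bd(2) unfolding cd[symmetric] by simp
    then show ?thesis using separated_two_gens[OF g, of a b] B_below[OF g(2,1)] by blast
  next
    case nc: False
    \<comment> \<open>Otherwise connectivity below \<open>d\<close> gives a rank two element whose
      generators are exactly \<open>a\<close> and \<open>b\<close>. It is not a square, so it equals
      both \<open>a \<otimes> b\<close> and \<open>b \<otimes> a\<close>.\<close>
    have "a \<notin> B d"
    proof
      assume "a \<in> B d"
      then have nb: "\<not> B d \<subseteq> {b}" using b by blast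
      have "gens_connected d" using connected_below d n by simp
      then obtain k where k: "k \<in> R d" "{b} \<inter> B k \<noteq> {}" "\<not> B k \<subseteq> {b}"
        using gens_connectedD[of d "{b}"] bd nb by blast
      have kd: "k \<in> carrier G" "k \<preceq> d" "len k = 2" using k by (auto simp: R_iff)
      have kc: "k \<in> R c" using k R_below d by blast
      have "B k \<subseteq> B d" using B_mono kd d by blast
      then have Bk: "B k = {a, b}" using k bd by blast
      have sq: "k \<noteq> t \<otimes> t" if "t \<in> A" for t using square[of t] kc that Bk b by force
      have nx: "inv t \<otimes> k \<in> {a, b}" "t \<otimes> (inv t \<otimes> k) = k" if t: "t \<in> {a, b}" for t
      proof -
        show "inv t \<otimes> k \<in> {a, b}" using next_B[OF kd(1,3), of t] t unfolding Bk .
        have "t \<in> carrier G" using t car by blast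
        then show "t \<otimes> (inv t \<otimes> k) = k" using kd by simp
      qed
      have "k = a \<otimes> b" using nx[of a] sq[OF A(1)] by auto
      moreover have "k = b \<otimes> a" using nx[of b] sq[OF A(2)] by auto
      ultimately show False using nc by simp
    qed
    then have Bd: "B d \<subseteq> {b}" using bd by blast
    obtain n where n': "len d = n" "2 \<le> n" using d n by simp
    have cn: "c = a \<otimes> b [^] n" using eq_power[OF A(2) d(1,2) Bd] cd n' by simp
    note pre = power_prefix[OF A cn, unfolded d(3) n'(1), OF refl]
    have pow: "b [^] (2::nat) = b \<otimes> b" "b [^] (3::nat) = b \<otimes> (b \<otimes> b)"
        "b [^] (4::nat) = b \<otimes> (b \<otimes> (b \<otimes> b))"
      using car by (simp_all add: numeral_eq_Suc m_assoc)
    let ?g3 = "a \<otimes> (b \<otimes> b)"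
    have g3: "?g3 \<preceq> c" "len ?g3 = 3" using pre[of 2] n' pow by simp_all
    have g3c: "?g3 \<in> carrier G" using car by simp
    have R3: "a \<otimes> b \<in> R ?g3" using reduced_triple[OF A A(2) refl g3(2)] by simp
    \<comment> \<open>In the cycle of \<open>a \<otimes> b\<close>, \<open>x\<close> follows
      \<open>b\<close> and \<open>v\<close> precedes \<open>a\<close>. By
      \<open>long_cycle_False\<close> they coincide, so the cycle closes after three steps.\<close>
    define x where "x = inv b \<otimes> a \<otimes> b"
    define v where "v = a \<otimes> b \<otimes> inv a"
    have xv: "x \<in> A" "v \<in> A" unfolding x_def v_def using conj_gen conj_gen' A by simp_all
    have eq: "b \<otimes> x = a \<otimes> b" "v \<otimes> a = a \<otimes> b"
      unfolding x_def v_def using car by (simp_all add: m_assoc)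
    have "x = v" using long_cycle_False[OF A xv refl g3(1) R3 eq nc] by blast
    then have xa: "x \<otimes> a = a \<otimes> b" using eq by simp
    have xc: "x \<in> carrier G" using xv by simp
    \<comment> \<open>Chosen so that \<open>b\<close>, \<open>q\<close>, \<open>x\<close> form a
      triad whose ear \<open>ear b x\<close> is \<open>a\<close>. Then \<open>a\<close> followed by
      two, three or four letters \<open>b\<close> becomes \<open>b x b\<close>,
      \<open>b q b q\<close> or \<open>b q b q b\<close>.\<close>
    define q where "q = inv b \<otimes> x \<otimes> b"
    have qA: "q \<in> A" unfolding q_def using conj_gen xv A by simp
    then have qc: "q \<in> carrier G" by simp
    have bq: "b \<otimes> q = x \<otimes> b" unfolding q_def using car xc by (simp add: m_assoc)
    have "b \<otimes> (q \<otimes> x) = x \<otimes> (a \<otimes> b)"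
      using mult_ext[OF bq car(2) qc xc car(2) xc] eq by simp
    also have "\<dots> = b \<otimes> (x \<otimes> b)"
      using mult_ext[of x a b x b] xa eq car xc by simp
    finally have qx: "q \<otimes> x = b \<otimes> q" using car qc xc bq by simp
    have "b \<noteq> q"
    proof
      assume "b = q"
      then have "b \<otimes> b = x \<otimes> b" using bq by simp
      then have "b = x" using car xc by simp
      then have "b \<otimes> b = a \<otimes> b" using eq by simp
      then show False using car b by simp
    qed
    then have tr: "triad b q x" unfolding triad_def using A qA xv qx bq by simp
    note t = triadD[OF tr]
    have ab: "a \<otimes> (b \<otimes> s) = b \<otimes> (x \<otimes> s)" if "s \<in> carrier G" for s
      using mult_ext[of a b b x s] eq that car xc by simp
    have e3: "?g3 = b \<otimes> (x \<otimes> b)" using ab[OF car(2)] .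
    have e4: "a \<otimes> (b \<otimes> (b \<otimes> b)) = b \<otimes> (q \<otimes> (b \<otimes> q))"
      using ab[of "b \<otimes> b"] t by simp
    have e5: "a \<otimes> (b \<otimes> (b \<otimes> (b \<otimes> b))) = b \<otimes> (q \<otimes> (b \<otimes> (q \<otimes> b)))"
      using ab[of "b \<otimes> (b \<otimes> b)"] t by simp
    have small: "separated g" if "len g \<le> 2" using separated_rank_le_2 g that by blast
    have top: "separated g" if "len g = len c" "separated c"
      using le_len_eq[OF g(2,1)] that by simp
    have le: "len g \<le> len c" using le_len g by blast
    consider "n = 2" | "n = 3" | "4 \<le> n" using n' by linarith
    then show ?thesis
    proof cases
      case 1
      then have "c = ?g3" using cn pow by simp
      then have "separated c" using braid3(4)[OF tr e3 g3] by simp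
      then show ?thesis using small top le d n' 1 by linarith
    next
      case 2
      have c4: "c = b \<otimes> (q \<otimes> (b \<otimes> q))" using cn pow e4 2 by simp
      have "c \<preceq> c" "len c = 4" using d n' 2 by simp_all
      note b4 = braid4[OF tr c4 this]
      show ?thesis
      proof (cases "len g = 3")
        case True
        let ?z = "inv g \<otimes> c"
        have z: "?z \<in> carrier G" "len ?z = 1" "c = g \<otimes> ?z"
          using g True \<open>len c = 4\<close> unfolding prefix_le_def by simp_all
        have zA: "?z \<in> A" using len_eq_1 z by blast
        \<comment> \<open>Moving the last letter \<open>?z\<close> of \<open>c\<close> to the front
          exhibits \<open>g\<close> as \<open>c\<close> with the first letter \<open>?s\<close>
          removed, the form handled by \<open>braid4\<close>.\<close>
        let ?s = "g \<otimes> ?z \<otimes> inv g"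
        have sA: "?s \<in> A" using conj_gen' g zA by blast
        have sc: "c = ?s \<otimes> g" using z g by (simp add: m_assoc)
        have "len (?s \<otimes> g) = len ?s + len g" using sc sA True \<open>len c = 4\<close> by simp
        then have "?s \<preceq> ?s \<otimes> g" using le_mult_iff[of ?s g] sA g by blast
        then have "?s \<in> B c" using sc sA by (simp add: B_iff)
        then have "separated (inv ?s \<otimes> c)" using b4(2) by blast
        moreover have "inv ?s \<otimes> c = inv ?s \<otimes> (?s \<otimes> g)" using sc by simp
        then have "inv ?s \<otimes> c = g" using inv_mult_cancel(1)[of ?s g] sA g by simp
        ultimately show ?thesis by simp
      next
        case False
        then show ?thesis using small top le b4(1) \<open>len c = 4\<close> by linarith
      qed
    next
      case 3
      let ?g5 = "a \<otimes> b [^] (4::nat)"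
      have g5: "?g5 \<preceq> c" using pre[of 4] 3 by simp
      have e: "?g5 = b \<otimes> (q \<otimes> (b \<otimes> (q \<otimes> b)))" unfolding pow using e5 .
      \<comment> \<open>This places \<open>b \<otimes> q\<close>, known to lie below
        \<open>?g3\<close>, below \<open>?g5\<close>, as \<open>triad_braid5_False\<close>
        requires.\<close>
      have "?g3 \<preceq> ?g5"
      proof -
        have 53: "?g5 = ?g3 \<otimes> (b \<otimes> b)" unfolding pow using car by (simp add: m_assoc)
        have "len ?g5 = 5" using pre[of 4] 3 by simp
        moreover have "len ?g5 \<le> len ?g3 + len (b \<otimes> b)" unfolding 53 using car len_mult_le by simp
        moreover have "len (b \<otimes> b) \<le> 2" using len_power_le[OF A(2), of 2] pow by simp
        ultimately have "len (?g3 \<otimes> (b \<otimes> b)) = len ?g3 + len (b \<otimes> b)" using g3(2) unfolding 53 by linarith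
        then show ?thesis unfolding 53 using le_mult_iff[of ?g3 "b \<otimes> b"] car by simp
      qed
      then have "R ?g3 \<subseteq> R ?g5" using R_mono car by simp
      then have "b \<otimes> q \<in> R ?g5" using braid3(2)[OF tr e3 g3] by blast
      then show ?thesis using triad_braid5_False[OF tr e g5] by blast
    qed
  qed
qed

end


theorem theorem6p8:
  fixes G :: "('a, 'b) monoid_scheme" and A :: "'a set" and c :: 'a and r :: "'a rel"
  assumes "group G"
    and "generates_as_monoid G A"
    and "conjugation_closed G A"
    and "\<one>\<^bsub>G\<^esub> \<notin> A"
    and "c \<in> carrier G"
    and "finite (gens_below G A c)"
    and "word_length G A c \<ge> 3"
    and "\<exists>a\<in>gens_below G A c.
           \<exists>!h. poset_covers (fact_poset G A c) (prefix_le G A) a h \<and> h \<noteq> a \<otimes>\<^bsub>G\<^esub> a"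
    and "totally_chain_connected (fact_poset G A c) (prefix_le G A)"
    and "compatible_order G A c r"
  shows "\<forall>g\<in>fact_poset G A c.
           induces_linear_order
             (reduced_cycle_graph G A g (r \<inter> gens_below G A g \<times> gens_below G A g))"
proof -
  interpret generated_group G A
    using assms(1-4) by (simp add: generated_group_def generated_group_axioms_def)
  have "linear_order_on (B c) r" using assms(10) by (simp add: compatible_order_def)
  then obtain \<rho> :: "'a \<Rightarrow> nat" where \<rho>: "inj_on \<rho> (B c)"
    "\<And>x y. x \<in> B c \<Longrightarrow> y \<in> B c \<Longrightarrow> (x, y) \<in> r \<longleftrightarrow> \<rho> x \<le> \<rho> y"
    using linear_order_rank assms(6) by blast
  interpret compatible_rank G A c \<rho>
  proof
    show "\<exists>!t. t \<in> B k \<and> \<rho> t \<le> \<rho> (inv\<^bsub>G\<^esub> t \<otimes>\<^bsub>G\<^esub> k)" if "k \<in> R c" for k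
      using compatible_order_ascent[OF assms(10,5) \<rho>(2) that] by blast
    show "gens_connected g" if "g \<in> carrier G" "g \<preceq> c" "2 \<le> len g" for g
      using totally_chain_connected_below[OF assms(9,5) that] .
  qed (use assms \<rho> in auto)
  obtain a where a: "a \<in> B c"
    and ex1: "\<exists>!h. poset_covers (fact_poset G A c) (prefix_le G A) a h \<and> h \<noteq> a \<otimes>\<^bsub>G\<^esub> a"
    using assms(8) by blast
  let ?d = "inv\<^bsub>G\<^esub> a \<otimes>\<^bsub>G\<^esub> c"
  note cov = covers_gen[OF a assms(5)]
  have ac: "a \<in> carrier G" using a by (auto simp: B_iff)
  from ex1 obtain b where b: "b \<in> B ?d" "b \<noteq> a" unfolding cov by blast
  \<comment> \<open>By cancellation a third generator would give a cover of \<open>a\<close>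
    different from both \<open>a \<otimes> b\<close> and the square of \<open>a\<close>.\<close>
  have "u = a \<or> u = b" if "u \<in> B ?d" for u
  proof (rule ccontr)
    assume "\<not> (u = a \<or> u = b)"
    moreover have car: "u \<in> carrier G" "b \<in> carrier G" using that b by (auto simp: B_iff)
    ultimately have "a \<otimes>\<^bsub>G\<^esub> u \<noteq> a \<otimes>\<^bsub>G\<^esub> a" "a \<otimes>\<^bsub>G\<^esub> u \<noteq> a \<otimes>\<^bsub>G\<^esub> b" "a \<otimes>\<^bsub>G\<^esub> b \<noteq> a \<otimes>\<^bsub>G\<^esub> a"
      using ac b by auto
    then show False using ex1 that b unfolding cov by blast
  qed
  then have "separated g" if "g \<in> carrier G" "g \<preceq> c" for g
    using all_separated[OF a b _ assms(7) that] by blast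
  then show ?thesis using separated_imp_linear \<rho>(2) by (auto simp: fact_poset_iff)
qed

end
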